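(* Let $X$ be a real-valued random process on $\mathbb{R}$ with stationary increments (with finite second moments), let $\psi$ be a wavelet as described in the context, and let $J\in\mathbb{Z}$. Suppose that for all $\tau\in\mathbb{R}$, all integers $j\leq J$ and all $a\in\mathbb{Z}$, $$C_{\rho W}(\tau;j,a)=C_{\rho W}(\tau;0,a).$$ Then for all integers $j\leq J$ and all $a,b\in\mathbb{Z}$, $$C_S(j,a,b)=C_S(0,a,b).$$
   Context: A wavelet $\psi:\mathbb{R}\to\mathbb{C}$ has fast decay away from $t=0$, zero average, $\int|\psi|^2=1$, and a real-valued Fourier transform. For $j\in\mathbb{Z}$, $\psi_j(t)=2^{-j}\psi(2^{-j}t)$ and $WX(t,j)=X\star\psi_j(t)$, stationary in $t$. For $z\in\mathbb{C}$, $\rho(z)=(z,|z|)$. The wavelet spectrum is $\sigma_W^2(j)=\mathbb{E}\{|X\star\psi_j(t)|^2\}$. The normalized phase-modulus correlation is the $2\times2$ matrix $$C_{\rho W}(\tau;j,a)=\frac{\mathbb{E}\{\rho WX(t,j)\,\rho WX(t-2^j\tau,j-a)^*\}}{\sigma_W(j)\,\sigma_W(j-a)},$$ where for $u,v\in\mathbb{C}^2$, $uv^*$ is the matrix with entries $u_k\overline{v_l}$. The scattering cross-spectrum is $$C_S(j,a,b)=\frac{\mathbb{E}\{\,|X\star\psi_j|\star\psi_{j-b}(t)\;\big(|X\star\psi_{j-a}|\star\psi_{j-b}(t)\big)^*\}}{\sigma_W(j)\,\sigma_W(j-a)},$$ independent of $t$; $^*$ denotes complex conjugation. *)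

theory Defs
  imports "HOL-Probability.Probability"
begin

definition is_wavelet :: "(real \<Rightarrow> complex) \<Rightarrow> bool" where
  "is_wavelet psi \<longleftrightarrow>
     psi \<in> borel_measurable borel \<and>
     (\<forall>n::nat. \<exists>C::real. \<forall>t. cmod (psi t) \<le> C / (1 + \<bar>t\<bar>) ^ n) \<and>
     (LINT t|lborel. psi t) = 0 \<and>
     (LINT t|lborel. (cmod (psi t))\<^sup>2) = 1 \<and>
     (\<forall>\<xi>::real. Im (LINT t|lborel. psi t * cis (- \<xi> * t)) = 0)"

definition psi_dil :: "(real \<Rightarrow> complex) \<Rightarrow> int \<Rightarrow> real \<Rightarrow> complex" where
  "psi_dil psi j t = complex_of_real (2 powr (- real_of_int j)) * psi (2 powr (- real_of_int j) * t)"

definition conv :: "(real \<Rightarrow> complex) \<Rightarrow> (real \<Rightarrow> complex) \<Rightarrow> real \<Rightarrow> complex" where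
  "conv f g t = (LINT s|lborel. f s * g (t - s))"

definition WX :: "('w \<Rightarrow> real \<Rightarrow> real) \<Rightarrow> (real \<Rightarrow> complex) \<Rightarrow> 'w \<Rightarrow> real \<Rightarrow> int \<Rightarrow> complex" where
  "WX X psi w t j = conv (\<lambda>s. complex_of_real (X w s)) (psi_dil psi j) t"

text \<open>Wavelet spectrum sigma_W(j) (square root of E|X * psi_j(t)|^2, evaluated at t = 0;
  it does not depend on t by stationarity).\<close>
definition sigmaW :: "'w measure \<Rightarrow> ('w \<Rightarrow> real \<Rightarrow> real) \<Rightarrow> (real \<Rightarrow> complex) \<Rightarrow> int \<Rightarrow> real" where
  "sigmaW M X psi j = sqrt (LINT w|M. (cmod (WX X psi w 0 j))\<^sup>2)"

definition rho :: "complex \<Rightarrow> complex ^ 2" where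
  "rho z = (\<chi> i. if i = 1 then z else complex_of_real (cmod z))"

definition outer :: "complex ^ 2 \<Rightarrow> complex ^ 2 \<Rightarrow> complex ^ 2 ^ 2" where
  "outer u v = (\<chi> k l. u $ k * cnj (v $ l))"

definition C_rhoW :: "'w measure \<Rightarrow> ('w \<Rightarrow> real \<Rightarrow> real) \<Rightarrow> (real \<Rightarrow> complex) \<Rightarrow> real
    \<Rightarrow> real \<Rightarrow> int \<Rightarrow> int \<Rightarrow> complex ^ 2 ^ 2" where
  "C_rhoW M X psi t \<tau> j a =
     (\<chi> k l. (LINT w|M. outer (rho (WX X psi w t j))
                              (rho (WX X psi w (t - 2 powr (real_of_int j) * \<tau>) (j - a))) $ k $ l)
             / complex_of_real (sigmaW M X psi j * sigmaW M X psi (j - a)))"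

definition C_S :: "'w measure \<Rightarrow> ('w \<Rightarrow> real \<Rightarrow> real) \<Rightarrow> (real \<Rightarrow> complex) \<Rightarrow> real
    \<Rightarrow> int \<Rightarrow> int \<Rightarrow> int \<Rightarrow> complex" where
  "C_S M X psi t j a b =
     (LINT w|M.
        conv (\<lambda>s. complex_of_real (cmod (WX X psi w s j))) (psi_dil psi (j - b)) t
        * cnj (conv (\<lambda>s. complex_of_real (cmod (WX X psi w s (j - a)))) (psi_dil psi (j - b)) t))
     / complex_of_real (sigmaW M X psi j * sigmaW M X psi (j - a))"

definition stationary_increments :: "'w measure \<Rightarrow> ('w \<Rightarrow> real \<Rightarrow> real) \<Rightarrow> bool" where
  "stationary_increments M X \<longleftrightarrow>
     (\<forall>I h. finite I \<longrightarrow>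
        distr M (PiM I (\<lambda>_. borel)) (\<lambda>w. \<lambda>t\<in>I. X w (t + h) - X w h)
      = distr M (PiM I (\<lambda>_. borel)) (\<lambda>w. \<lambda>t\<in>I. X w t - X w 0))"

end

theory Submission
  imports Defs
begin

text \<open>By Fubini, the scattering cross-spectrum is the integral, against
  \<open>\<psi>\<^bsub>j-b\<^esub>(t - r) \<psi>\<^bsub>j-b\<^esub>(t - r')\<^sup>*\<close>, of the normalized correlation of \<open>|X \<star> \<psi>\<^sub>j|(r)\<close> and
  \<open>|X \<star> \<psi>\<^bsub>j-a\<^esub>|(r')\<close>, which is the last entry of the phase-modulus correlation. After rescaling
  by \<open>2\<^sup>j\<close>, the hypothesis turns it into the same integral at scale \<open>0\<close>, up to a shift of the time
  origin, so that what remains is the joint stationarity of \<open>|X \<star> \<psi>\<^sub>j|\<close> and \<open>|X \<star> \<psi>\<^bsub>j-a\<^esub>|\<close>.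

  Stationarity of the increments only concerns finitely many times, whereas \<open>X \<star> \<psi>\<^sub>j\<close> is an integral
  of a process that is merely measurable. It is therefore approximated in mean square by empirical
  averages over sample points, chosen simultaneously for the original and the shifted times.
  Integrability rests on the at most quadratic growth of the variance of the increments.\<close>

section \<open>Processes with stationary increments\<close>

lemma sq_diff_le: "(a - b)\<^sup>2 \<le> 2 * (a - c)\<^sup>2 + 2 * (b - c)\<^sup>2" for a b c :: real
  using zero_le_power2[of "a + b - 2 * c"] by (simp add: power2_eq_square algebra_simps)

locale increment_process = prob_space M for M :: "'w measure" +
  fixes X :: "'w \<Rightarrow> real \<Rightarrow> real"
  assumes X_measurable: "case_prod X \<in> borel_measurable (M \<Otimes>\<^sub>M borel)"
    and stationary: "stationary_increments M X"
    and X_square: "\<And>t. integrable M (\<lambda>w. (X w t)\<^sup>2)"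
begin

lemma X_measurable_joint [measurable (raw)]:
  assumes [measurable]: "f \<in> N \<rightarrow>\<^sub>M M" "g \<in> borel_measurable N"
  shows "(\<lambda>x. X (f x) (g x)) \<in> borel_measurable N"
proof -
  have "(\<lambda>x. case_prod X (f x, g x)) \<in> borel_measurable N"
    by (rule measurable_compose[OF _ X_measurable]) simp
  then show ?thesis by simp
qed

lemma increment_square: "integrable M (\<lambda>w. (X w s - X w r)\<^sup>2)"
proof (rule Bochner_Integration.integrable_bound)
  show "integrable M (\<lambda>w. 2 * (X w s)\<^sup>2 + 2 * (X w r)\<^sup>2)"
    using X_square by simp
  show "AE w in M. norm ((X w s - X w r)\<^sup>2) \<le> norm (2 * (X w s)\<^sup>2 + 2 * (X w r)\<^sup>2)"
    using sq_diff_le[where c = 0] by simp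
qed measurable

text \<open>Stationarity enters the development only here: equality of the finite-dimensional laws
  of the increments, transported through \<open>distr\<close>, becomes equality of expectations of
  functionals of finitely many increments.\<close>

lemma integral_increments_shift:
  fixes F :: "(real \<Rightarrow> real) \<Rightarrow> real"
  assumes "finite I" and [measurable]: "F \<in> borel_measurable (PiM I (\<lambda>_. borel))"
  shows "(LINT w|M. F (\<lambda>t\<in>I. X w (t + h) - X w h)) = (LINT w|M. F (\<lambda>t\<in>I. X w t - X w 0))"
proof -
  have "(LINT w|M. F (\<lambda>t\<in>I. X w (t + h) - X w h))
      = integral\<^sup>L (distr M (PiM I (\<lambda>_. borel)) (\<lambda>w. \<lambda>t\<in>I. X w (t + h) - X w h)) F"
    by (rule integral_distr[symmetric]) measurable
  also have "\<dots> = integral\<^sup>L (distr M (PiM I (\<lambda>_. borel)) (\<lambda>w. \<lambda>t\<in>I. X w t - X w 0)) F"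
    using stationary[unfolded stationary_increments_def, rule_format, OF \<open>finite I\<close>, of h]
    by (simp only:)
  also have "\<dots> = (LINT w|M. F (\<lambda>t\<in>I. X w t - X w 0))"
    by (rule integral_distr) measurable
  finally show ?thesis .
qed

section \<open>Growth of the variance of the increments\<close>

definition variogram :: "real \<Rightarrow> real" where
  "variogram h = (LINT w|M. (X w h - X w 0)\<^sup>2)"

lemma variogram_measurable [measurable]: "variogram \<in> borel_measurable borel"
  unfolding variogram_def by measurable

lemma variogram_nonneg: "0 \<le> variogram h"
  unfolding variogram_def by simp

lemma variogram_increment: "(LINT w|M. (X w s - X w r)\<^sup>2) = variogram (s - r)"
  using integral_increments_shift[of "{s - r}" "\<lambda>x. (x (s - r))\<^sup>2" r]
  by (simp add: variogram_def)

text \<open>A quasi-triangle inequality: passing through time 0 splits the increment from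
  \<open>r\<close> to \<open>s\<close> into two increments whose variances are
  \<open>variogram s\<close> and \<open>variogram r\<close>.\<close>

lemma variogram_diff_le: "variogram (s - r) \<le> 2 * variogram s + 2 * variogram r"
proof -
  have "variogram (s - r) = (LINT w|M. (X w s - X w r)\<^sup>2)"
    by (rule variogram_increment[symmetric])
  also have "\<dots> \<le> (LINT w|M. 2 * (X w s - X w 0)\<^sup>2 + 2 * (X w r - X w 0)\<^sup>2)"
    by (intro integral_mono sq_diff_le increment_square Bochner_Integration.integrable_add
        integrable_mult_right)
  also have "\<dots> = 2 * variogram s + 2 * variogram r"
    by (simp add: variogram_def increment_square)
  finally show ?thesis .
qed

text \<open>The variogram is even, so \<open>t\<close> and \<open>-t\<close> contribute equally. The
  factor 4 is exactly the growth of the square under doubling, so iterating it costs no more than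
  quadratic growth.\<close>

lemma variogram_double_le: "variogram (2 * t) \<le> 4 * variogram t"
proof -
  have "variogram (- t) = variogram t"
    using variogram_increment[of 0 t] variogram_def[of t] by (simp add: power2_commute)
  then show ?thesis using variogram_diff_le[of t "- t"] by simp
qed

text \<open>A sublevel set of \<open>variogram\<close> that fills more than three quarters of \<open>[0, 2]\<close> meets its translates
  by small \<open>h\<close>.\<close>
lemma variogram_locally_bounded: "\<exists>B. \<forall>h. \<bar>h\<bar> \<le> 1/4 \<longrightarrow> variogram h \<le> B"
proof -
  define S where "S n = {s \<in> {0..2}. variogram s \<le> real n}" for n :: nat
  have S [measurable]: "S n \<in> sets borel" for n
    unfolding S_def by measurable
  have "(\<lambda>n. emeasure lborel (S n)) \<longlonglongrightarrow> emeasure lborel (\<Union>n. S n)"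
  proof (rule Lim_emeasure_incseq)
    show "incseq S"
      by (intro incseq_SucI) (auto simp: S_def)
  qed auto
  moreover have "(\<Union>n. S n) = {0..2}"
    using real_arch_simple by (auto simp: S_def)
  ultimately have "(\<lambda>n. emeasure lborel (S n)) \<longlonglongrightarrow> ennreal 2"
    by simp
  then have "\<forall>\<^sub>F n in sequentially. ennreal (3/2) < emeasure lborel (S n)"
    by (rule order_tendstoD) (simp add: ennreal_less_iff)
  then obtain n where n: "ennreal (3/2) < emeasure lborel (S n)"
    by (auto simp: eventually_sequentially)
  have "variogram h \<le> 4 * real n" if h: "\<bar>h\<bar> \<le> 1/4" for h
  proof -
    have "\<exists>s. s \<in> S n \<and> s - h \<in> S n"
    proof (rule ccontr)
      assume "\<not> ?thesis"
      \<comment> \<open>Both the set and its translate lie in an interval of length 5/2. Were they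
        disjoint, their total measure, which exceeds 3, would have to fit there.\<close>
      then have disj: "indicator (S n) s + indicator (S n) (s - h) \<le> (indicator {-1/4..9/4} s :: ennreal)" for s
        using h by (auto simp: S_def indicator_def)
      have "emeasure lborel (S n) = (\<integral>\<^sup>+ s. indicator (S n) (s - h) \<partial>lborel)"
        using nn_integral_real_affine[of "indicator (S n)" 1 "- h"] by simp
      then have "emeasure lborel (S n) + emeasure lborel (S n)
          = (\<integral>\<^sup>+ s. indicator (S n) s + indicator (S n) (s - h) \<partial>lborel)"
        by (subst nn_integral_add) auto
      also have "\<dots> \<le> (\<integral>\<^sup>+ s. indicator {-1/4..9/4::real} s \<partial>lborel)"
        by (intro nn_integral_mono disj)
      also have "\<dots> = ennreal (5/2)"
        by simp
      finally have "emeasure lborel (S n) + emeasure lborel (S n) \<le> ennreal (5/2)" .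
      moreover have "ennreal (3/2) + ennreal (3/2) \<le> emeasure lborel (S n) + emeasure lborel (S n)"
        using n by (intro add_mono) auto
      ultimately have "ennreal (3/2) + ennreal (3/2) \<le> ennreal (5/2)"
        by (rule order_trans[rotated])
      moreover have "ennreal (3/2) + ennreal (3/2) = ennreal (3/2 + 3/2)"
        by (rule ennreal_plus[symmetric]) auto
      ultimately show False by simp
    qed
    then obtain s where "s \<in> S n" "s - h \<in> S n" by auto
    \<comment> \<open>Since \<open>h = s - (s - h)\<close>, the quasi-triangle inequality bounds the
      variogram at \<open>h\<close> by \<open>2 * n + 2 * n\<close>.\<close>
    then show ?thesis
      using variogram_diff_le[of s "s - h"] by (simp add: S_def)
  qed
  then show ?thesis by blast
qed

text \<open>Halve \<open>t\<close> until it falls into the window where the variogram is bounded,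
  then come back by the doubling inequality.\<close>

lemma variogram_quadratic_growth: "\<exists>B\<ge>0. \<forall>t. variogram t \<le> B * (1 + t\<^sup>2)"
proof -
  obtain B where B: "\<And>h. \<bar>h\<bar> \<le> 1/4 \<Longrightarrow> variogram h \<le> B"
    using variogram_locally_bounded by blast
  have B0: "0 \<le> B" using B[of 0] variogram_nonneg[of 0] by simp
  \<comment> \<open>The induction is on the number of halvings. The first doubling out of the window
    gives at most \<open>4 * B\<close>, while the square of \<open>t\<close> is at least 1/16 there;
    hence the constant 64. Further doublings multiply both sides by 4.\<close>
  have *: "\<bar>t\<bar> \<le> 2 ^ k / 4 \<Longrightarrow> 1/4 < \<bar>t\<bar> \<Longrightarrow> variogram t \<le> 64 * B * t\<^sup>2" for t and k :: nat
  proof (induction k arbitrary: t)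
    case 0
    then show ?case by simp
  next
    case (Suc k)
    have t: "(1/4)\<^sup>2 \<le> t\<^sup>2" using Suc.prems(2) by (subst abs_le_square_iff[symmetric]) simp
    show ?case
    proof (cases "\<bar>t/2\<bar> \<le> 1/4")
      case True
      then have "variogram t \<le> 4 * B" using B[of "t/2"] variogram_double_le[of "t/2"] by simp
      also have "4 * B \<le> 64 * B * t\<^sup>2"
        using mult_left_mono[OF t, of "64 * B"] B0 by (simp add: power2_eq_square)
      finally show ?thesis .
    next
      case False
      then have "variogram (t/2) \<le> 64 * B * (t/2)\<^sup>2"
        using Suc.IH[of "t/2"] Suc.prems by simp
      then show ?thesis using variogram_double_le[of "t/2"] by (simp add: power_divide)
    qed
  qed
  have "variogram t \<le> 64 * B * (1 + t\<^sup>2)" for t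
  proof (cases "\<bar>t\<bar> \<le> 1/4")
    case True
    have "variogram t \<le> B" using B True .
    also have "B \<le> 64 * B * (1 + t\<^sup>2)" using B0 by (simp add: algebra_simps add_increasing2)
    finally show ?thesis .
  next
    case False
    obtain k where "4 * \<bar>t\<bar> < 2 ^ k" using real_arch_pow[of 2 "4 * \<bar>t\<bar>"] by auto
    then show ?thesis using *[of t k] False B0 by (simp add: algebra_simps add_increasing2)
  qed
  then show ?thesis using B0 by (intro exI[of _ "64 * B"]) auto
qed

lemma second_moment_growth: "\<exists>A\<ge>0. \<forall>t. (LINT w|M. (X w t)\<^sup>2) \<le> A * (1 + t\<^sup>2)"
proof -
  obtain B where B: "0 \<le> B" "\<And>t. variogram t \<le> B * (1 + t\<^sup>2)"
    using variogram_quadratic_growth by blast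
  define D where "D = (LINT w|M. (X w 0)\<^sup>2)"
  have D: "0 \<le> D" unfolding D_def by simp
  have "(LINT w|M. (X w t)\<^sup>2) \<le> (2 * B + 2 * D) * (1 + t\<^sup>2)" for t
  proof -
    have "(LINT w|M. (X w t)\<^sup>2) \<le> (LINT w|M. 2 * (X w t - X w 0)\<^sup>2 + 2 * (X w 0)\<^sup>2)"
    proof (rule integral_mono)
      show "(X w t)\<^sup>2 \<le> 2 * (X w t - X w 0)\<^sup>2 + 2 * (X w 0)\<^sup>2" for w
        using sq_diff_le[of "X w t" 0 "X w 0"] by simp
    qed (simp_all add: increment_square X_square)
    also have "\<dots> = 2 * variogram t + 2 * D"
      by (simp add: variogram_def D_def increment_square X_square)
    also have "\<dots> \<le> 2 * (B * (1 + t\<^sup>2)) + 2 * D * (1 + t\<^sup>2)"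
      using mult_left_mono[OF B(2)[of t], of 2] mult_left_mono[of 1 "1 + t\<^sup>2" "2 * D"] D by simp
    finally show ?thesis by (simp add: algebra_simps)
  qed
  then show ?thesis using B D by (intro exI[of _ "2 * B + 2 * D"]) auto
qed

end

section \<open>Averages over a probability measure\<close>

text \<open>The centred variable is orthogonal to constants, so adding it to \<open>c\<close> adds
  its variance to the squared norm of \<open>c\<close>. Here \<open>c\<close> stands for the error
  accumulated by earlier samples, and the vector-valued form lets several processes be sampled
  together.\<close>

lemma (in prob_space) variance_identity:
  fixes f :: "'a \<Rightarrow> 'e::euclidean_space"
  assumes [measurable]: "f \<in> borel_measurable M"
    and sq: "integrable M (\<lambda>u. (norm (f u))\<^sup>2)"
  shows "integrable M f"
    and "(\<integral>\<^sup>+ u. ennreal ((norm (c + (f u - integral\<^sup>L M f)))\<^sup>2) \<partial>M)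
       = ennreal ((norm c)\<^sup>2 + (LINT u|M. (norm (f u))\<^sup>2) - (norm (integral\<^sup>L M f))\<^sup>2)"
proof -
  have "integrable M (\<lambda>u. norm (f u))"
    by (rule square_integrable_imp_integrable) (use sq in auto)
  then show f: "integrable M f"
    by (simp add: integrable_norm_iff)
  define m where "m = integral\<^sup>L M f"
  have eq: "(norm (c + (f u - m)))\<^sup>2 = (norm (c - m))\<^sup>2 + 2 * inner (c - m) (f u) + (norm (f u))\<^sup>2" for u
    unfolding power2_norm_eq_inner by (simp add: inner_simps inner_commute)
  have "(\<integral>\<^sup>+ u. ennreal ((norm (c + (f u - m)))\<^sup>2) \<partial>M) = ennreal (LINT u|M. (norm (c + (f u - m)))\<^sup>2)"
  proof (rule nn_integral_eq_integral)
    show "integrable M (\<lambda>u. (norm (c + (f u - m)))\<^sup>2)"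
      unfolding eq using f sq by simp
  qed simp
  also have "(LINT u|M. (norm (c + (f u - m)))\<^sup>2)
      = (norm (c - m))\<^sup>2 + 2 * inner (c - m) m + (LINT u|M. (norm (f u))\<^sup>2)"
    unfolding eq using f sq by (simp add: m_def prob_space)
  also have "\<dots> = (norm c)\<^sup>2 + (LINT u|M. (norm (f u))\<^sup>2) - (norm m)\<^sup>2"
    unfolding power2_norm_eq_inner by (simp add: inner_simps inner_commute)
  finally show "(\<integral>\<^sup>+ u. ennreal ((norm (c + (f u - integral\<^sup>L M f)))\<^sup>2) \<partial>M)
       = ennreal ((norm c)\<^sup>2 + (LINT u|M. (norm (f u))\<^sup>2) - (norm (integral\<^sup>L M f))\<^sup>2)"
    by (simp add: m_def)
qed

text \<open>Jensen's inequality for the squared norm, read off from the nonnegativity of the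
  variance. If the second moment is infinite, so is the right-hand side.\<close>

lemma (in prob_space) norm_integral_sq_le:
  fixes f :: "'a \<Rightarrow> 'e::euclidean_space"
  assumes [measurable]: "f \<in> borel_measurable M"
  shows "ennreal ((norm (integral\<^sup>L M f))\<^sup>2) \<le> (\<integral>\<^sup>+ u. ennreal ((norm (f u))\<^sup>2) \<partial>M)"
proof (cases "integrable M (\<lambda>u. (norm (f u))\<^sup>2)")
  case True
  have "0 \<le> (norm (0::'e))\<^sup>2 + (LINT u|M. (norm (f u))\<^sup>2) - (norm (integral\<^sup>L M f))\<^sup>2"
  proof -
    have "0 \<le> (LINT u|M. (norm (f u - integral\<^sup>L M f))\<^sup>2)" by simp
    also have "\<dots> = (LINT u|M. (norm (f u))\<^sup>2 - 2 * inner (integral\<^sup>L M f) (f u) + (norm (integral\<^sup>L M f))\<^sup>2)"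
      by (intro Bochner_Integration.integral_cong refl)
         (simp add: power2_norm_eq_inner inner_simps inner_commute)
    also have "\<dots> = (LINT u|M. (norm (f u))\<^sup>2) - (norm (integral\<^sup>L M f))\<^sup>2"
      using True variance_identity(1)[OF assms True] by (simp add: prob_space power2_norm_eq_inner)
    finally show ?thesis by simp
  qed
  then show ?thesis
    using True by (subst nn_integral_eq_integral) (auto intro!: ennreal_leI)
next
  case False
  then have "(\<integral>\<^sup>+ u. ennreal ((norm (f u))\<^sup>2) \<partial>M) = \<infinity>"
    by (auto simp: integrable_iff_bounded less_top[symmetric])
  then show ?thesis by simp
qed

text \<open>Maurey's empirical method: averaged over \<open>u\<close>, adding \<open>Y u\<close> minus its mean to a fixed vector
  raises the squared norm by at most the second moment of \<open>Y\<close>, so the sample points can be chosen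
  one after the other.\<close>
lemma empirical_approximation:
  fixes Y :: "'w \<Rightarrow> 'b \<Rightarrow> 'e::euclidean_space"
  assumes "prob_space N" "sigma_finite_measure M"
    and Y [measurable]: "case_prod Y \<in> borel_measurable (M \<Otimes>\<^sub>M N)"
    and C: "(\<integral>\<^sup>+ w. \<integral>\<^sup>+ u. ennreal ((norm (Y w u))\<^sup>2) \<partial>N \<partial>M) \<le> ennreal C" and "0 \<le> C"
  shows "\<exists>u. (\<forall>i. u i \<in> space N) \<and>
    (\<integral>\<^sup>+ w. ennreal ((norm ((\<Sum>i<n. Y w (u i)) - real n *\<^sub>R integral\<^sup>L N (Y w)))\<^sup>2) \<partial>M)
      \<le> ennreal (real n * (C + 1))"
proof (induction n)
  case 0
  interpret N: prob_space N by fact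
  show ?case using N.not_empty by (auto intro!: exI[of _ "\<lambda>_. SOME x. x \<in> space N"] some_in_eq[THEN iffD2])
next
  case (Suc n)
  interpret N: prob_space N by fact
  interpret M: sigma_finite_measure M by fact
  interpret P: pair_sigma_finite M N ..
  obtain u where u: "\<And>i. u i \<in> space N"
    and le: "(\<integral>\<^sup>+ w. ennreal ((norm ((\<Sum>i<n. Y w (u i)) - real n *\<^sub>R integral\<^sup>L N (Y w)))\<^sup>2) \<partial>M)
      \<le> ennreal (real n * (C + 1))"
    using Suc by blast
  define Z where "Z w = integral\<^sup>L N (Y w)" for w
  define T where "T w = (\<Sum>i<n. Y w (u i)) - real n *\<^sub>R Z w" for w
  have Z [measurable]: "Z \<in> borel_measurable M" unfolding Z_def by measurable
  have Yu: "(\<lambda>w. Y w v) \<in> borel_measurable M" if "v \<in> space N" for v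
    using measurable_compose[OF measurable_Pair2'[OF that] Y] by simp
  have T [measurable]: "T \<in> borel_measurable M" unfolding T_def using Yu u by measurable
  \<comment> \<open>The variance identity applies only where the slice of \<open>Y\<close> is square
    integrable, which the bound on the double integral ensures for almost every
    \<open>w\<close>.\<close>
  have fin: "AE w in M. (\<integral>\<^sup>+ u. ennreal ((norm (Y w u))\<^sup>2) \<partial>N) \<noteq> \<infinity>"
    using C by (intro nn_integral_PInf_AE) (auto simp: top_unique)
  have "(\<integral>\<^sup>+ v. (\<integral>\<^sup>+ w. ennreal ((norm (T w + (Y w v - Z w)))\<^sup>2) \<partial>M) \<partial>N)
      = (\<integral>\<^sup>+ w. (\<integral>\<^sup>+ v. ennreal ((norm (T w + (Y w v - Z w)))\<^sup>2) \<partial>N) \<partial>M)"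
    by (rule P.Fubini') measurable
  also have "\<dots> \<le> (\<integral>\<^sup>+ w. ennreal ((norm (T w))\<^sup>2) + (\<integral>\<^sup>+ v. ennreal ((norm (Y w v))\<^sup>2) \<partial>N) \<partial>M)"
  proof (rule nn_integral_mono_AE)
    show "AE w in M. (\<integral>\<^sup>+ v. ennreal ((norm (T w + (Y w v - Z w)))\<^sup>2) \<partial>N)
        \<le> ennreal ((norm (T w))\<^sup>2) + (\<integral>\<^sup>+ v. ennreal ((norm (Y w v))\<^sup>2) \<partial>N)"
      using fin AE_space
    proof eventually_elim
      case (elim w)
      have [measurable]: "Y w \<in> borel_measurable N"
        using measurable_compose[OF measurable_Pair1'[OF elim(2)] Y] by simp
      have sq: "integrable N (\<lambda>v. (norm (Y w v))\<^sup>2)"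
        using elim(1) by (simp add: integrable_iff_bounded less_top)
      have "(\<integral>\<^sup>+ v. ennreal ((norm (T w + (Y w v - Z w)))\<^sup>2) \<partial>N)
          \<le> ennreal ((norm (T w))\<^sup>2 + (LINT v|N. (norm (Y w v))\<^sup>2))"
        unfolding Z_def by (subst N.variance_identity(2)[OF _ sq]) (simp, rule ennreal_leI, simp)
      also have "\<dots> = ennreal ((norm (T w))\<^sup>2) + (\<integral>\<^sup>+ v. ennreal ((norm (Y w v))\<^sup>2) \<partial>N)"
        using sq by (simp add: nn_integral_eq_integral)
      finally show ?case .
    qed
  qed
  also have "\<dots> = (\<integral>\<^sup>+ w. ennreal ((norm (T w))\<^sup>2) \<partial>M) + (\<integral>\<^sup>+ w. \<integral>\<^sup>+ v. ennreal ((norm (Y w v))\<^sup>2) \<partial>N \<partial>M)"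
    by (rule nn_integral_add) measurable
  also have "\<dots> \<le> ennreal (real n * (C + 1)) + ennreal C"
    using le C by (intro add_mono) (auto simp: T_def Z_def)
  \<comment> \<open>The spare 1 in \<open>C + 1\<close> makes the mean over the next sample point
    strictly smaller than the target. Hence some point \<open>v\<close> reaches the target.\<close>
  also have "\<dots> < ennreal (real (Suc n) * (C + 1))"
    using \<open>0 \<le> C\<close> by (subst ennreal_plus[symmetric]) (auto intro!: ennreal_lessI simp: algebra_simps add_pos_nonneg)
  finally have lt: "(\<integral>\<^sup>+ v. (\<integral>\<^sup>+ w. ennreal ((norm (T w + (Y w v - Z w)))\<^sup>2) \<partial>M) \<partial>N)
      < ennreal (real (Suc n) * (C + 1))" .
  obtain v where v: "v \<in> space N"
    "(\<integral>\<^sup>+ w. ennreal ((norm (T w + (Y w v - Z w)))\<^sup>2) \<partial>M) \<le> ennreal (real (Suc n) * (C + 1))"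
  proof (rule ccontr)
    assume "\<not> thesis"
    then have "(\<integral>\<^sup>+ v. ennreal (real (Suc n) * (C + 1)) \<partial>N)
        \<le> (\<integral>\<^sup>+ v. (\<integral>\<^sup>+ w. ennreal ((norm (T w + (Y w v - Z w)))\<^sup>2) \<partial>M) \<partial>N)"
      using that by (intro nn_integral_mono) (metis linear)
    then show False using lt by (simp add: N.emeasure_space_1)
  qed
  have eq: "(\<Sum>i<Suc n. Y w ((u(n := v)) i)) - real (Suc n) *\<^sub>R integral\<^sup>L N (Y w) = T w + (Y w v - Z w)" for w
    by (simp add: T_def Z_def algebra_simps)
  show ?case
  proof (intro exI[of _ "u(n := v)"] conjI)
    show "\<forall>i. (u(n := v)) i \<in> space N"
      using u v by simp
  qed (use v(2) in \<open>simp only: eq\<close>)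
qed

section \<open>Wavelets as weights of a Cauchy measure\<close>

lemma cnj_measurable [measurable]: "cnj \<in> borel_measurable borel"
  by (intro borel_measurable_continuous_onI continuous_intros)

text \<open>The standard Cauchy distribution serves as reference measure: Lebesgue integrals against
  a wavelet become expectations, to which Jensen's inequality and random sampling apply.\<close>

definition cauchy_measure :: "real measure" where
  "cauchy_measure = density lborel (\<lambda>u. ennreal (1 / (pi * (1 + u\<^sup>2))))"

lemma sets_cauchy_measure [simp, measurable_cong]: "sets cauchy_measure = sets borel"
  by (simp add: cauchy_measure_def)

lemma space_cauchy_measure [simp]: "space cauchy_measure = UNIV"
  by (simp add: cauchy_measure_def)

lemma prob_space_cauchy_measure: "prob_space cauchy_measure"
proof
  have int: "integrable lborel (\<lambda>u::real. inverse (1 + u\<^sup>2))"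
    using integrable_inverse_1_plus_square
    by (simp add: set_integrable_def einterval_def)
  have "(LINT u|lborel. inverse (1 + u\<^sup>2)) = pi"
    using LBINT_inverse_1_plus_square
    by (simp add: interval_lebesgue_integral_def set_lebesgue_integral_def einterval_def)
  then have "(LINT u|lborel. 1 / (pi * (1 + u\<^sup>2))) = 1"
    using int by (simp add: divide_inverse)
  moreover have "integrable lborel (\<lambda>u::real. 1 / (pi * (1 + u\<^sup>2)))"
    using int by (simp add: divide_inverse)
  ultimately have "(\<integral>\<^sup>+ u. ennreal (1 / (pi * (1 + u\<^sup>2))) \<partial>lborel) = 1"
    by (subst nn_integral_eq_integral) auto
  then show "emeasure cauchy_measure (space cauchy_measure) = 1"
    by (simp add: cauchy_measure_def emeasure_density)
qed

interpretation cauchy: prob_space cauchy_measure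
  by (rule prob_space_cauchy_measure)

text \<open>The density of the filter with respect to the Cauchy measure.\<close>

definition weight :: "(real \<Rightarrow> complex) \<Rightarrow> real \<Rightarrow> complex" where
  "weight \<phi> u = complex_of_real (pi * (1 + u\<^sup>2)) * \<phi> u"

text \<open>The decay is of order 4 because two orders are spent on dividing by the Cauchy density,
  and the remaining two let the squared weight absorb the quadratic growth of second
  moments.\<close>

definition decaying :: "(real \<Rightarrow> complex) \<Rightarrow> bool" where
  "decaying \<phi> \<longleftrightarrow> \<phi> \<in> borel_measurable borel \<and> (\<exists>B. \<forall>u. cmod (\<phi> u) \<le> B / (1 + u\<^sup>2)\<^sup>2)"

lemma one_plus_square_pos: "0 < 1 + (u::real)\<^sup>2"
  by (simp add: add_pos_nonneg)

lemma decaying_measurable: "decaying \<phi> \<Longrightarrow> \<phi> \<in> borel_measurable borel"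
  by (simp add: decaying_def)

lemma weight_measurable [measurable]:
  assumes [measurable]: "\<phi> \<in> borel_measurable borel"
  shows "weight \<phi> \<in> borel_measurable borel"
  unfolding weight_def[abs_def] by measurable

text \<open>The Cauchy density cancels the prefactor in \<open>weight\<close> pointwise. If the
  product is not integrable, both sides are 0 by convention.\<close>

lemma integral_weight:
  assumes [measurable]: "f \<in> borel_measurable borel" "\<phi> \<in> borel_measurable borel"
  shows "(LINT u|cauchy_measure. f u * weight \<phi> u) = (LINT u|lborel. f u * \<phi> u)"
proof -
  have "(LINT u|cauchy_measure. f u * weight \<phi> u)
      = (LINT u|lborel. (1 / (pi * (1 + u\<^sup>2))) *\<^sub>R (f u * weight \<phi> u))"
    unfolding cauchy_measure_def by (rule integral_density) (auto intro!: AE_I2)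
  also have "\<dots> = (LINT u|lborel. f u * \<phi> u)"
  proof (intro Bochner_Integration.integral_cong refl)
    fix u :: real
    have "(1 / (pi * (1 + u\<^sup>2))) * (pi * (1 + u\<^sup>2)) = 1"
      using one_plus_square_pos[of u] by simp
    then have "complex_of_real (1 / (pi * (1 + u\<^sup>2))) * complex_of_real (pi * (1 + u\<^sup>2)) = 1"
      by (metis of_real_1 of_real_mult)
    then show "(1 / (pi * (1 + u\<^sup>2))) *\<^sub>R (f u * weight \<phi> u) = f u * \<phi> u"
      unfolding weight_def scaleR_conv_of_real by (metis mult.assoc mult.left_commute mult.left_neutral)
  qed
  finally show ?thesis .
qed

lemma weight_bound:
  assumes "decaying \<phi>"
  shows "\<exists>B\<ge>0. \<forall>u. (1 + u\<^sup>2) * (cmod (weight \<phi> u))\<^sup>2 \<le> B"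
proof -
  obtain B where B: "\<And>u. cmod (\<phi> u) \<le> B / (1 + u\<^sup>2)\<^sup>2"
    using assms unfolding decaying_def by blast
  have "(1 + u\<^sup>2) * (cmod (weight \<phi> u))\<^sup>2 \<le> (pi * B)\<^sup>2" for u
  proof -
    let ?q = "1 + u\<^sup>2"
    have q: "0 < ?q" "1 \<le> ?q" using one_plus_square_pos[of u] by auto
    have "cmod (weight \<phi> u) = pi * ?q * cmod (\<phi> u)"
      using q by (simp add: weight_def norm_mult del: of_real_add of_real_mult)
    also have "\<dots> \<le> pi * ?q * (B / ?q\<^sup>2)"
      using B[of u] q by (intro mult_left_mono) auto
    also have "\<dots> = pi * B / ?q"
      using q by (simp add: power2_eq_square)
    finally have "(cmod (weight \<phi> u))\<^sup>2 \<le> (pi * B / ?q)\<^sup>2"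
      by (intro power_mono) auto
    then have "?q * (cmod (weight \<phi> u))\<^sup>2 \<le> ?q * (pi * B / ?q)\<^sup>2"
      using q by (intro mult_left_mono) auto
    also have "\<dots> = (pi * B)\<^sup>2 / ?q"
      using q by (simp add: power2_eq_square)
    also have "\<dots> \<le> (pi * B)\<^sup>2 / 1"
      using q by (intro divide_left_mono) (auto simp: one_plus_square_pos)
    finally show ?thesis by simp
  qed
  then show ?thesis by (intro exI[of _ "(pi * B)\<^sup>2"]) auto
qed

lemma psi_dil_decaying:
  assumes "is_wavelet psi"
  shows "decaying (psi_dil psi j)"
proof -
  have [measurable]: "psi \<in> borel_measurable borel"
    using assms by (simp add: is_wavelet_def)
  define c where "c = 2 powr (- real_of_int j)"
  have c: "0 < c" by (simp add: c_def)
  \<comment> \<open>Exponent 4 matches \<open>decaying\<close>, because the square of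
    \<open>1 + \<bar>t\<bar>\<close> dominates 1 plus the square of \<open>t\<close>.\<close>
  obtain C where C: "\<And>t. cmod (psi t) \<le> C / (1 + \<bar>t\<bar>) ^ 4"
    using assms unfolding is_wavelet_def by blast
  have C0: "0 \<le> C" using order_trans[OF norm_ge_zero C[of 0]] by simp
  \<comment> \<open>The factor \<open>d\<close> compares the quadratic weights in \<open>u\<close>
    and in \<open>c * u\<close>, whether the dilation stretches or shrinks.\<close>
  define d where "d = min 1 (c\<^sup>2)"
  have d: "0 < d" "d \<le> 1" "d \<le> c\<^sup>2" using c by (auto simp: d_def)
  have "cmod (psi_dil psi j u) \<le> (c * C / d\<^sup>2) / (1 + u\<^sup>2)\<^sup>2" for u
  proof -
    have "d * u\<^sup>2 \<le> (c * u)\<^sup>2"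
      using mult_right_mono[OF d(3), of "u\<^sup>2"] by (simp add: power_mult_distrib)
    then have "d * (1 + u\<^sup>2) \<le> 1 + (c * u)\<^sup>2"
      using d(2) by (simp add: distrib_left)
    also have "\<dots> \<le> (1 + \<bar>c * u\<bar>)\<^sup>2"
      by (simp add: power2_sum)
    finally have "(d * (1 + u\<^sup>2))\<^sup>2 \<le> ((1 + \<bar>c * u\<bar>)\<^sup>2)\<^sup>2"
      using d(1) by (intro power_mono) auto
    then have le: "d\<^sup>2 * (1 + u\<^sup>2)\<^sup>2 \<le> (1 + \<bar>c * u\<bar>) ^ 4"
      by (simp add: power_mult_distrib power_mult[symmetric])
    have pos: "0 < d\<^sup>2 * (1 + u\<^sup>2)\<^sup>2"
      using d(1) one_plus_square_pos[of u] by simp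
    have "cmod (psi_dil psi j u) = c * cmod (psi (c * u))"
      using c by (simp add: psi_dil_def c_def norm_mult)
    also have "\<dots> \<le> c * (C / (1 + \<bar>c * u\<bar>) ^ 4)"
      using C[of "c * u"] c by (intro mult_left_mono) auto
    also have "\<dots> \<le> c * (C / (d\<^sup>2 * (1 + u\<^sup>2)\<^sup>2))"
      using c C0 le pos by (intro mult_left_mono divide_left_mono) auto
    finally show ?thesis by simp
  qed
  moreover have "psi_dil psi j \<in> borel_measurable borel"
    unfolding psi_dil_def[abs_def] by measurable
  ultimately show ?thesis unfolding decaying_def by blast
qed

text \<open>Substituting \<open>s = t - 2 powr j * u\<close> gives a Jacobian that cancels the
  normalization of the dilated wavelet. All dependence on \<open>j\<close> moves into the times at
  which \<open>f\<close> is read, and the filter stays at scale \<open>k\<close>.\<close>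

lemma conv_psi_dil:
  "conv f (psi_dil psi (j + k)) t
     = (LINT u|lborel. f (t - 2 powr real_of_int j * u) * psi_dil psi k u)"
proof -
  define c :: real where "c = 2 powr real_of_int j"
  have c: "0 < c" by (simp add: c_def)
  have dil: "psi_dil psi (j + k) (c * u) = complex_of_real (1 / c) * psi_dil psi k u" for u
    by (simp add: psi_dil_def c_def powr_add powr_minus powr_diff divide_simps)
  have "conv f (psi_dil psi (j + k)) t
      = c *\<^sub>R (LINT u|lborel. f (t + - c * u) * psi_dil psi (j + k) (t - (t + - c * u)))"
    unfolding conv_def using lborel_integral_real_affine[of "- c" "\<lambda>s. f s * psi_dil psi (j + k) (t - s)" t] c
    by simp
  also have "\<dots> = (LINT u|lborel. c *\<^sub>R (f (t + - c * u) * psi_dil psi (j + k) (c * u)))"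
    by simp
  also have "\<dots> = (LINT u|lborel. f (t - c * u) * psi_dil psi k u)"
    using c by (intro Bochner_Integration.integral_cong refl) (simp add: dil scaleR_conv_of_real)
  finally show ?thesis by (simp add: c_def)
qed

lemma conv_psi_dil_0: "conv f (psi_dil psi k) t = (LINT u|lborel. f (t - u) * psi_dil psi k u)"
  using conv_psi_dil[of f psi 0 k t] by simp

text \<open>The integral is a convolution with the constant 1, and rescaling it by \<open>k\<close>
  reduces it to the zero average of \<open>psi\<close>.\<close>

lemma integral_psi_dil:
  assumes "is_wavelet psi"
  shows "(LINT u|lborel. psi_dil psi k u) = 0"
proof -
  have "(LINT u|lborel. psi_dil psi k u) = conv (\<lambda>_. 1) (psi_dil psi (k + 0)) 0"
    using conv_psi_dil_0[of "\<lambda>_. 1" psi k 0] by simp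
  also have "\<dots> = 0"
    using assms conv_psi_dil[of "\<lambda>_. 1" psi k 0 0] by (simp add: psi_dil_def is_wavelet_def)
  finally show ?thesis .
qed

section \<open>Second moments\<close>

text \<open>Bridge between \<open>ennreal\<close> bounds, which pass through Tonelli freely, and the
  Bochner integrals in which moments are computed.\<close>

lemma square_integrable_iff_nn:
  fixes f :: "'a \<Rightarrow> 'e::euclidean_space"
  assumes [measurable]: "f \<in> borel_measurable M" and "0 \<le> C"
  shows "(\<integral>\<^sup>+ w. ennreal ((norm (f w))\<^sup>2) \<partial>M) \<le> ennreal C
    \<longleftrightarrow> integrable M (\<lambda>w. (norm (f w))\<^sup>2) \<and> (LINT w|M. (norm (f w))\<^sup>2) \<le> C"
proof
  assume le: "(\<integral>\<^sup>+ w. ennreal ((norm (f w))\<^sup>2) \<partial>M) \<le> ennreal C"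
  then have "(\<integral>\<^sup>+ w. ennreal ((norm (f w))\<^sup>2) \<partial>M) < \<infinity>"
    using le_less_trans[OF le] by simp
  then have int: "integrable M (\<lambda>w. (norm (f w))\<^sup>2)"
    by (simp add: integrable_iff_bounded)
  then show "integrable M (\<lambda>w. (norm (f w))\<^sup>2) \<and> (LINT w|M. (norm (f w))\<^sup>2) \<le> C"
    using le \<open>0 \<le> C\<close> by (simp add: nn_integral_eq_integral ennreal_le_iff)
next
  assume "integrable M (\<lambda>w. (norm (f w))\<^sup>2) \<and> (LINT w|M. (norm (f w))\<^sup>2) \<le> C"
  then show "(\<integral>\<^sup>+ w. ennreal ((norm (f w))\<^sup>2) \<partial>M) \<le> ennreal C"
    by (simp add: nn_integral_eq_integral ennreal_leI)
qed

text \<open>A second moment bound uniform in \<open>u\<close> survives averaging over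
  \<open>N\<close>, by Tonelli and then Jensen. Finite second moments on a probability space also
  give integrability of almost every path.\<close>

lemma second_moment_integral_le:
  fixes G :: "'w \<Rightarrow> 'b \<Rightarrow> 'e::euclidean_space"
  assumes "prob_space N" "prob_space M"
    and G [measurable]: "case_prod G \<in> borel_measurable (M \<Otimes>\<^sub>M N)"
    and le: "\<And>u. u \<in> space N \<Longrightarrow> (\<integral>\<^sup>+ w. ennreal ((norm (G w u))\<^sup>2) \<partial>M) \<le> ennreal C"
  shows "(\<integral>\<^sup>+ w. \<integral>\<^sup>+ u. ennreal ((norm (G w u))\<^sup>2) \<partial>N \<partial>M) \<le> ennreal C"
    and "(\<integral>\<^sup>+ w. ennreal ((norm (integral\<^sup>L N (G w)))\<^sup>2) \<partial>M) \<le> ennreal C"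
    and "AE w in M. integrable N (G w)"
proof -
  interpret N: prob_space N by fact
  interpret M: prob_space M by fact
  interpret P: pair_sigma_finite M N ..
  have slice: "G w \<in> borel_measurable N" if "w \<in> space M" for w
    using measurable_compose[OF measurable_Pair1'[OF that] G] by simp
  have "(\<integral>\<^sup>+ w. \<integral>\<^sup>+ u. ennreal ((norm (G w u))\<^sup>2) \<partial>N \<partial>M)
      = (\<integral>\<^sup>+ u. \<integral>\<^sup>+ w. ennreal ((norm (G w u))\<^sup>2) \<partial>M \<partial>N)"
    by (rule P.Fubini'[symmetric]) measurable
  also have "\<dots> \<le> (\<integral>\<^sup>+ u. ennreal C \<partial>N)"
    by (rule nn_integral_mono) (rule le)
  also have "\<dots> = ennreal C" by (simp add: N.emeasure_space_1)
  finally show *: "(\<integral>\<^sup>+ w. \<integral>\<^sup>+ u. ennreal ((norm (G w u))\<^sup>2) \<partial>N \<partial>M) \<le> ennreal C" .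
  have "(\<integral>\<^sup>+ w. ennreal ((norm (integral\<^sup>L N (G w)))\<^sup>2) \<partial>M)
      \<le> (\<integral>\<^sup>+ w. \<integral>\<^sup>+ u. ennreal ((norm (G w u))\<^sup>2) \<partial>N \<partial>M)"
    by (intro nn_integral_mono N.norm_integral_sq_le slice)
  with * show "(\<integral>\<^sup>+ w. ennreal ((norm (integral\<^sup>L N (G w)))\<^sup>2) \<partial>M) \<le> ennreal C"
    by (rule order_trans[rotated])
  have "AE w in M. (\<integral>\<^sup>+ u. ennreal ((norm (G w u))\<^sup>2) \<partial>N) \<noteq> \<infinity>"
    using * by (intro nn_integral_PInf_AE) (auto simp: top_unique)
  then show "AE w in M. integrable N (G w)"
    using AE_space
  proof eventually_elim
    case (elim w)
    have [measurable]: "G w \<in> borel_measurable N"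
      using slice[OF elim(2)] .
    have "integrable N (\<lambda>u. (norm (G w u))\<^sup>2)"
      using elim(1) by (simp add: integrable_iff_bounded less_top)
    then show ?case
      by (rule N.variance_identity(1)[rotated]) measurable
  qed
qed

text \<open>Fubini on \<open>M\<close> times two copies of \<open>N\<close>. Absolute integrability
  comes from bounding a product by the sum of the squares of its factors, whose expectations are
  uniformly bounded.\<close>

lemma cross_moment_integral:
  fixes G1 G2 :: "'w \<Rightarrow> 'b \<Rightarrow> complex"
  assumes "prob_space N" "prob_space M"
    and [measurable]: "case_prod G1 \<in> borel_measurable (M \<Otimes>\<^sub>M N)"
      "case_prod G2 \<in> borel_measurable (M \<Otimes>\<^sub>M N)"
    and le1: "\<And>u. u \<in> space N \<Longrightarrow> (\<integral>\<^sup>+ w. ennreal ((cmod (G1 w u))\<^sup>2) \<partial>M) \<le> ennreal C"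
    and le2: "\<And>u. u \<in> space N \<Longrightarrow> (\<integral>\<^sup>+ w. ennreal ((cmod (G2 w u))\<^sup>2) \<partial>M) \<le> ennreal C"
  shows "(LINT w|M. (LINT u|N. G1 w u) * cnj (LINT v|N. G2 w v))
    = (LINT u|N. LINT v|N. LINT w|M. G1 w u * cnj (G2 w v))"
proof -
  interpret N: prob_space N by fact
  interpret M: prob_space M by fact
  interpret NN: pair_sigma_finite N N ..
  interpret P: prob_space "N \<Otimes>\<^sub>M N"
    by (intro prob_space_pair) fact+
  interpret MP: pair_sigma_finite M "N \<Otimes>\<^sub>M N" ..
  define H where "H w p = G1 w (fst p) * cnj (G2 w (snd p))" for w p
  have H [measurable]: "case_prod H \<in> borel_measurable (M \<Otimes>\<^sub>M (N \<Otimes>\<^sub>M N))"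
    unfolding H_def by measurable
  have "(\<integral>\<^sup>+ x. ennreal (norm (case_prod H x)) \<partial>(M \<Otimes>\<^sub>M (N \<Otimes>\<^sub>M N)))
      = (\<integral>\<^sup>+ p. \<integral>\<^sup>+ w. ennreal (cmod (H w p)) \<partial>M \<partial>(N \<Otimes>\<^sub>M N))"
    by (subst MP.nn_integral_snd[symmetric]) (auto intro!: nn_integral_cong)
  also have "\<dots> \<le> (\<integral>\<^sup>+ p. ennreal C + ennreal C \<partial>(N \<Otimes>\<^sub>M N))"
  proof (rule nn_integral_mono)
    fix p assume p: "p \<in> space (N \<Otimes>\<^sub>M N)"
    then have [measurable]: "fst p \<in> space N" "snd p \<in> space N"
      by (auto simp: space_pair_measure)
    have "(\<integral>\<^sup>+ w. ennreal (cmod (H w p)) \<partial>M)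
        \<le> (\<integral>\<^sup>+ w. ennreal ((cmod (G1 w (fst p)))\<^sup>2) + ennreal ((cmod (G2 w (snd p)))\<^sup>2) \<partial>M)"
    proof (rule nn_integral_mono)
      fix w
      have "0 \<le> (cmod (G1 w (fst p)) - cmod (G2 w (snd p)))\<^sup>2" by simp
      moreover have "0 \<le> cmod (G1 w (fst p)) * cmod (G2 w (snd p))" by simp
      ultimately have "cmod (H w p) \<le> (cmod (G1 w (fst p)))\<^sup>2 + (cmod (G2 w (snd p)))\<^sup>2"
        unfolding H_def norm_mult complex_mod_cnj power2_diff by linarith
      then show "ennreal (cmod (H w p)) \<le> ennreal ((cmod (G1 w (fst p)))\<^sup>2) + ennreal ((cmod (G2 w (snd p)))\<^sup>2)"
        by (simp add: ennreal_plus[symmetric] ennreal_leI del: ennreal_plus)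
    qed
    also have "\<dots> = (\<integral>\<^sup>+ w. ennreal ((cmod (G1 w (fst p)))\<^sup>2) \<partial>M) + (\<integral>\<^sup>+ w. ennreal ((cmod (G2 w (snd p)))\<^sup>2) \<partial>M)"
      by (rule nn_integral_add) measurable
    also have "\<dots> \<le> ennreal C + ennreal C"
      by (intro add_mono le1 le2) fact+
    finally show "(\<integral>\<^sup>+ w. ennreal (cmod (H w p)) \<partial>M) \<le> ennreal C + ennreal C" .
  qed
  also have "\<dots> < \<infinity>"
    by (simp add: P.emeasure_space_1 ennreal_add_less_top)
  finally have int: "integrable (M \<Otimes>\<^sub>M (N \<Otimes>\<^sub>M N)) (case_prod H)"
    by (simp add: integrable_iff_bounded)
  have "(LINT w|M. (LINT u|N. G1 w u) * cnj (LINT v|N. G2 w v))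
      = (LINT w|M. LINT u|N. LINT v|N. H w (u, v))"
    by (simp add: H_def)
  \<comment> \<open>The iterated integral over \<open>u\<close> and \<open>v\<close> is merged into
    one over the product space for those \<open>w\<close> whose slice is integrable, which is almost
    all of them.\<close>
  also have "\<dots> = (LINT w|M. LINT p|(N \<Otimes>\<^sub>M N). H w p)"
  proof (rule integral_cong_AE)
    show "AE w in M. (LINT u|N. LINT v|N. H w (u, v)) = (LINT p|(N \<Otimes>\<^sub>M N). H w p)"
      using MP.AE_integrable_fst'[OF int]
      by eventually_elim (simp add: NN.integral_fst')
  qed measurable
  also have "\<dots> = (LINT p|(N \<Otimes>\<^sub>M N). LINT w|M. H w p)"
    by (rule MP.Fubini_integral[symmetric]) (rule int)
  also have "\<dots> = (LINT u|N. LINT v|N. LINT w|M. H w (u, v))"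
  proof (rule NN.integral_fst'[symmetric])
    show "integrable (N \<Otimes>\<^sub>M N) (\<lambda>p. LINT w|M. H w p)"
      by (rule MP.integrable_snd) (rule int)
  qed
  finally show ?thesis by (simp add: H_def)
qed

text \<open>Mean-square closeness controls products of moduli through the weighted inequality
  between arithmetic and geometric mean. The parameter \<open>m\<close> balances the two terms: with
  errors of order \<open>1 / m^2\<close> the whole bound is of order \<open>1 / m\<close>.\<close>

lemma product_expectation_approx:
  fixes W1 W2 S1 S2 :: "'w \<Rightarrow> complex"
  assumes [measurable]: "W1 \<in> borel_measurable M" "W2 \<in> borel_measurable M"
      "S1 \<in> borel_measurable M" "S2 \<in> borel_measurable M"
    and W: "integrable M (\<lambda>w. (cmod (W1 w))\<^sup>2)" "integrable M (\<lambda>w. (cmod (W2 w))\<^sup>2)"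
    and S: "integrable M (\<lambda>w. (cmod (S1 w - W1 w))\<^sup>2)" "integrable M (\<lambda>w. (cmod (S2 w - W2 w))\<^sup>2)"
    and m: "1 \<le> m"
  shows "\<bar>(LINT w|M. cmod (W1 w) * cmod (W2 w)) - (LINT w|M. cmod (S1 w) * cmod (S2 w))\<bar>
    \<le> ((LINT w|M. (cmod (W1 w))\<^sup>2) + (LINT w|M. (cmod (W2 w))\<^sup>2)) / m
      + m * ((LINT w|M. (cmod (S1 w - W1 w))\<^sup>2) + (LINT w|M. (cmod (S2 w - W2 w))\<^sup>2))"
proof -
  define R where "R w = ((cmod (W1 w))\<^sup>2 + (cmod (W2 w))\<^sup>2) / m
      + m * ((cmod (S1 w - W1 w))\<^sup>2 + (cmod (S2 w - W2 w))\<^sup>2)" for w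
  have R: "integrable M R" unfolding R_def using W S by simp
  have amgm: "x * y \<le> (x\<^sup>2 / m + m * y\<^sup>2) / 2" for x y
  proof -
    have "0 \<le> (x / sqrt m - sqrt m * y)\<^sup>2" by simp
    also have "\<dots> = x\<^sup>2 / m + m * y\<^sup>2 - 2 * (x * y)"
      using m by (simp add: power2_diff power_divide power_mult_distrib)
    finally show ?thesis by simp
  qed
  have le: "\<bar>cmod (W1 w) * cmod (W2 w) - cmod (S1 w) * cmod (S2 w)\<bar> \<le> R w" for w
  proof -
    define a b a' b' where ab: "a = cmod (W1 w)" "b = cmod (W2 w)" "a' = cmod (S1 w)" "b' = cmod (S2 w)"
    define p q where pq: "p = \<bar>a' - a\<bar>" "q = \<bar>b' - b\<bar>"
    have "\<bar>a * b - a' * b'\<bar> = \<bar>a * (b' - b) + b * (a' - a) + (a' - a) * (b' - b)\<bar>"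
      by (subst abs_minus_commute) (simp add: algebra_simps)
    also have "\<dots> \<le> a * q + b * p + p * q"
      using abs_triangle_ineq[of "a * (b' - b) + b * (a' - a)" "(a' - a) * (b' - b)"]
        abs_triangle_ineq[of "a * (b' - b)" "b * (a' - a)"]
      by (simp add: ab pq abs_mult)
    also have "\<dots> \<le> (a\<^sup>2 / m + m * q\<^sup>2) / 2 + (b\<^sup>2 / m + m * p\<^sup>2) / 2 + (m * p\<^sup>2 + m * q\<^sup>2) / 2"
    proof -
      have "p\<^sup>2 \<le> m * p\<^sup>2" "q\<^sup>2 \<le> m * q\<^sup>2"
        using m mult_right_mono[of 1 m "p\<^sup>2"] mult_right_mono[of 1 m "q\<^sup>2"] by auto
      moreover have "p * q \<le> (p\<^sup>2 + q\<^sup>2) / 2"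
        using sum_squares_bound[of p q] by simp
      ultimately have "p * q \<le> (m * p\<^sup>2 + m * q\<^sup>2) / 2" by simp
      then show ?thesis using amgm[of a q] amgm[of b p] by linarith
    qed
    also have "\<dots> \<le> (a\<^sup>2 + b\<^sup>2) / m + m * (p\<^sup>2 + q\<^sup>2)"
    proof -
      have "0 \<le> a\<^sup>2 / m" "0 \<le> b\<^sup>2 / m" using m by auto
      then show ?thesis by (simp add: add_divide_distrib distrib_left)
    qed
    also have "\<dots> \<le> (a\<^sup>2 + b\<^sup>2) / m + m * ((cmod (S1 w - W1 w))\<^sup>2 + (cmod (S2 w - W2 w))\<^sup>2)"
    proof -
      have "p \<le> cmod (S1 w - W1 w)" "q \<le> cmod (S2 w - W2 w)"
        unfolding pq ab by (rule norm_triangle_ineq3)+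
      moreover have "0 \<le> p" "0 \<le> q" by (simp_all add: pq)
      ultimately have "p\<^sup>2 \<le> (cmod (S1 w - W1 w))\<^sup>2" "q\<^sup>2 \<le> (cmod (S2 w - W2 w))\<^sup>2"
        by (simp_all add: power_mono)
      then show ?thesis using m by (intro add_left_mono mult_left_mono) auto
    qed
    finally show ?thesis by (simp add: ab R_def)
  qed
  have WW: "integrable M (\<lambda>w. cmod (W1 w) * cmod (W2 w))"
  proof (rule Bochner_Integration.integrable_bound)
    show "integrable M (\<lambda>w. (cmod (W1 w))\<^sup>2 + (cmod (W2 w))\<^sup>2)" using W by simp
    show "AE w in M. norm (cmod (W1 w) * cmod (W2 w)) \<le> norm ((cmod (W1 w))\<^sup>2 + (cmod (W2 w))\<^sup>2)"
    proof (rule AE_I2)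
      fix w
      have "2 * cmod (W1 w) * cmod (W2 w) \<le> (cmod (W1 w))\<^sup>2 + (cmod (W2 w))\<^sup>2"
        by (rule sum_squares_bound)
      moreover have "0 \<le> cmod (W1 w) * cmod (W2 w)" by simp
      ultimately have "cmod (W1 w) * cmod (W2 w) \<le> (cmod (W1 w))\<^sup>2 + (cmod (W2 w))\<^sup>2" by linarith
      then show "norm (cmod (W1 w) * cmod (W2 w)) \<le> norm ((cmod (W1 w))\<^sup>2 + (cmod (W2 w))\<^sup>2)" by simp
    qed
  qed measurable
  \<comment> \<open>Only the \<open>W\<close>'s and the errors are known to be square integrable.
    The product of the \<open>S\<close>'s is therefore integrable as the product of the
    \<open>W\<close>'s minus a difference dominated by \<open>R\<close>.\<close>
  have D: "integrable M (\<lambda>w. cmod (W1 w) * cmod (W2 w) - cmod (S1 w) * cmod (S2 w))"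
    using R by (rule Bochner_Integration.integrable_bound)
      (use le order_trans[OF le abs_ge_self] in auto)
  have SS: "integrable M (\<lambda>w. cmod (S1 w) * cmod (S2 w))"
    using Bochner_Integration.integrable_diff[OF WW D] by simp
  have "\<bar>(LINT w|M. cmod (W1 w) * cmod (W2 w)) - (LINT w|M. cmod (S1 w) * cmod (S2 w))\<bar>
      = \<bar>LINT w|M. cmod (W1 w) * cmod (W2 w) - cmod (S1 w) * cmod (S2 w)\<bar>"
    using WW SS by simp
  also have "\<dots> \<le> (LINT w|M. \<bar>cmod (W1 w) * cmod (W2 w) - cmod (S1 w) * cmod (S2 w)\<bar>)"
    by (rule integral_abs_bound)
  also have "\<dots> \<le> integral\<^sup>L M R"
    using D R le by (intro integral_mono) auto
  also have "\<dots> = ((LINT w|M. (cmod (W1 w))\<^sup>2) + (LINT w|M. (cmod (W2 w))\<^sup>2)) / m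
      + m * ((LINT w|M. (cmod (S1 w - W1 w))\<^sup>2) + (LINT w|M. (cmod (S2 w - W2 w))\<^sup>2))"
    unfolding R_def using W S by simp
  finally show ?thesis .
qed

text \<open>Peetre's inequality: it separates the time \<open>t\<close> from the lag
  \<open>u\<close>, so that the weight can absorb the latter.\<close>

lemma one_plus_square_diff_le: "1 + (t - u)\<^sup>2 \<le> 2 * (1 + t\<^sup>2) * (1 + u\<^sup>2)" for t u :: real
proof -
  have "2 * (1 + t\<^sup>2) * (1 + u\<^sup>2) = 2 + 2 * t\<^sup>2 + 2 * u\<^sup>2 + 2 * (t * u)\<^sup>2"
    by (simp add: algebra_simps power_mult_distrib)
  moreover have "(t - u)\<^sup>2 \<le> 2 * t\<^sup>2 + 2 * u\<^sup>2"
    using sq_diff_le[of t u 0] by simp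
  ultimately show ?thesis
    using zero_le_power2[of "t * u"] by linarith
qed

section \<open>Stationarity of the modulus of the wavelet transform\<close>

context increment_process
begin

text \<open>The convolution of \<open>X\<close> with the filter, written as an expectation under the
  Cauchy measure; \<open>WX_eq_filt\<close> identifies it with the wavelet transform.\<close>

definition filt :: "(real \<Rightarrow> complex) \<Rightarrow> 'w \<Rightarrow> real \<Rightarrow> complex" where
  "filt \<phi> w t = (LINT u|cauchy_measure. complex_of_real (X w (t - u)) * weight \<phi> u)"

lemma filt_measurable:
  assumes "decaying \<phi>"
  shows "case_prod (filt \<phi>) \<in> borel_measurable (M \<Otimes>\<^sub>M borel)"
proof -
  have [measurable]: "\<phi> \<in> borel_measurable borel" using assms by (rule decaying_measurable)
  show ?thesis unfolding filt_def[abs_def] case_prod_beta' by measurable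
qed

text \<open>For a filter of zero average, subtracting \<open>X w t\<close> does not alter the
  integral almost surely, and it leaves an integrand built from increments, the only quantities that
  stationarity speaks about.\<close>

definition incr :: "(real \<Rightarrow> complex) \<Rightarrow> real \<Rightarrow> 'w \<Rightarrow> real \<Rightarrow> complex" where
  "incr \<phi> t w u = complex_of_real (X w (t - u) - X w t) * weight \<phi> u"

lemma incr_measurable:
  assumes "decaying \<phi>"
  shows "case_prod (incr \<phi> t) \<in> borel_measurable (M \<Otimes>\<^sub>M borel)"
proof -
  have [measurable]: "\<phi> \<in> borel_measurable borel" using assms by (rule decaying_measurable)
  show ?thesis unfolding incr_def[abs_def] case_prod_beta' by measurable
qed

lemma kernel_second_moment:
  assumes "decaying \<phi>"
  shows "\<exists>C\<ge>0. \<forall>t u. (\<integral>\<^sup>+ w. ennreal ((cmod (complex_of_real (X w (t - u)) * weight \<phi> u))\<^sup>2) \<partial>M)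
      \<le> ennreal (C * (1 + t\<^sup>2))"
proof -
  obtain A where A: "0 \<le> A" "\<And>t. (LINT w|M. (X w t)\<^sup>2) \<le> A * (1 + t\<^sup>2)"
    using second_moment_growth by blast
  obtain B where B: "0 \<le> B" "\<And>u. (1 + u\<^sup>2) * (cmod (weight \<phi> u))\<^sup>2 \<le> B"
    using weight_bound[OF assms] by blast
  have "(\<integral>\<^sup>+ w. ennreal ((cmod (complex_of_real (X w (t - u)) * weight \<phi> u))\<^sup>2) \<partial>M)
      \<le> ennreal ((2 * A * B) * (1 + t\<^sup>2))" for t u
  proof -
    have shift: "1 + (t - u)\<^sup>2 \<le> 2 * (1 + t\<^sup>2) * (1 + u\<^sup>2)"
      by (rule one_plus_square_diff_le)
    have "(LINT w|M. (cmod (complex_of_real (X w (t - u)) * weight \<phi> u))\<^sup>2)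
        = (LINT w|M. (X w (t - u))\<^sup>2) * (cmod (weight \<phi> u))\<^sup>2"
      by (simp add: norm_mult power_mult_distrib)
    also have "\<dots> \<le> (A * (2 * (1 + t\<^sup>2) * (1 + u\<^sup>2))) * (cmod (weight \<phi> u))\<^sup>2"
      using order_trans[OF A(2)[of "t - u"] mult_left_mono[OF shift A(1)]]
      by (rule mult_right_mono) simp
    also have "\<dots> = 2 * A * (1 + t\<^sup>2) * ((1 + u\<^sup>2) * (cmod (weight \<phi> u))\<^sup>2)"
      by (simp only: mult_ac)
    also have "\<dots> \<le> 2 * A * (1 + t\<^sup>2) * B"
      using A(1) by (intro mult_left_mono B) (auto simp: add_nonneg_nonneg)
    finally have "(LINT w|M. (cmod (complex_of_real (X w (t - u)) * weight \<phi> u))\<^sup>2)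
        \<le> (2 * A * B) * (1 + t\<^sup>2)" by (simp only: mult_ac)
    moreover have "integrable M (\<lambda>w. (cmod (complex_of_real (X w (t - u)) * weight \<phi> u))\<^sup>2)"
      by (simp add: norm_mult power_mult_distrib X_square)
    ultimately show ?thesis
      using A(1) B(1) by (subst square_integrable_iff_nn) (auto intro!: mult_nonneg_nonneg)
  qed
  then show ?thesis using A(1) B(1) by (intro exI[of _ "2 * A * B"]) auto
qed

lemma filt_second_moment:
  assumes "decaying \<phi>"
  shows "\<exists>C\<ge>0. \<forall>t. (\<integral>\<^sup>+ w. ennreal ((cmod (filt \<phi> w t))\<^sup>2) \<partial>M) \<le> ennreal (C * (1 + t\<^sup>2))"
proof -
  have [measurable]: "\<phi> \<in> borel_measurable borel" using assms by (rule decaying_measurable)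
  obtain C where C: "0 \<le> C" "\<And>t u. (\<integral>\<^sup>+ w. ennreal ((cmod (complex_of_real (X w (t - u)) * weight \<phi> u))\<^sup>2) \<partial>M)
      \<le> ennreal (C * (1 + t\<^sup>2))"
    using kernel_second_moment[OF assms] by blast
  have "(\<integral>\<^sup>+ w. ennreal ((cmod (filt \<phi> w t))\<^sup>2) \<partial>M) \<le> ennreal (C * (1 + t\<^sup>2))" for t
    unfolding filt_def
    by (rule second_moment_integral_le(2)[OF prob_space_cauchy_measure prob_space_axioms _ C(2)]) measurable
  then show ?thesis using C(1) by blast
qed

text \<open>The variance of the increment depends on the lag \<open>u\<close> alone and grows at
  most quadratically, which the squared weight compensates. The bound is thus uniform in
  \<open>t\<close> as well.\<close>

lemma incr_second_moment:
  assumes "decaying \<phi>"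
  shows "\<exists>C\<ge>0. \<forall>t u. (\<integral>\<^sup>+ w. ennreal ((cmod (incr \<phi> t w u))\<^sup>2) \<partial>M) \<le> ennreal C"
proof -
  obtain B where B: "0 \<le> B" "\<And>t. variogram t \<le> B * (1 + t\<^sup>2)"
    using variogram_quadratic_growth by blast
  obtain D where D: "0 \<le> D" "\<And>u. (1 + u\<^sup>2) * (cmod (weight \<phi> u))\<^sup>2 \<le> D"
    using weight_bound[OF assms] by blast
  have "(\<integral>\<^sup>+ w. ennreal ((cmod (incr \<phi> t w u))\<^sup>2) \<partial>M) \<le> ennreal (B * D)" for t u
  proof -
    have eq: "(cmod (incr \<phi> t w u))\<^sup>2 = (X w (t - u) - X w t)\<^sup>2 * (cmod (weight \<phi> u))\<^sup>2" for w
      unfolding incr_def norm_mult norm_of_real by (simp add: power_mult_distrib)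
    have "(LINT w|M. (cmod (incr \<phi> t w u))\<^sup>2) = variogram (- u) * (cmod (weight \<phi> u))\<^sup>2"
      by (simp add: eq variogram_increment)
    also have "\<dots> \<le> B * (1 + u\<^sup>2) * (cmod (weight \<phi> u))\<^sup>2"
      using B(2)[of "- u"] by (intro mult_right_mono) auto
    also have "\<dots> \<le> B * D"
      unfolding mult.assoc using B(1) by (intro mult_left_mono D)
    finally have "(LINT w|M. (cmod (incr \<phi> t w u))\<^sup>2) \<le> B * D" .
    moreover have "integrable M (\<lambda>w. (cmod (incr \<phi> t w u))\<^sup>2)"
      unfolding eq by (intro integrable_mult_left increment_square)
    moreover have "(\<lambda>w. incr \<phi> t w u) \<in> borel_measurable M"
      unfolding incr_def by measurable
    ultimately show ?thesis
      using B(1) D(1) by (subst square_integrable_iff_nn) auto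
  qed
  then show ?thesis using B(1) D(1) by (intro exI[of _ "B * D"]) auto
qed

text \<open>The weight has zero mean, so the term \<open>X w t\<close> drops out. Splitting the
  integral requires the increment part to be integrable, which is known for almost every
  path.\<close>

lemma filt_eq_incr:
  assumes "decaying \<phi>" "(LINT u|lborel. \<phi> u) = 0"
  shows "AE w in M. filt \<phi> w t = (LINT u|cauchy_measure. incr \<phi> t w u)"
proof -
  have [measurable]: "\<phi> \<in> borel_measurable borel" using assms by (intro decaying_measurable)
  obtain C where C: "\<And>t u. (\<integral>\<^sup>+ w. ennreal ((cmod (incr \<phi> t w u))\<^sup>2) \<partial>M) \<le> ennreal C"
    using incr_second_moment[OF assms(1)] by blast
  have int: "AE w in M. integrable cauchy_measure (incr \<phi> t w)"
    by (rule second_moment_integral_le(3)[OF prob_space_cauchy_measure prob_space_axioms _ C])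
       (use incr_measurable[OF assms(1)] in measurable)
  have w0: "(LINT u|cauchy_measure. weight \<phi> u) = 0"
    using integral_weight[of "\<lambda>_. 1" \<phi>] assms(2) by simp
  have wint: "integrable cauchy_measure (weight \<phi>)"
  proof -
    obtain D where D: "0 \<le> D" "\<And>u. (1 + u\<^sup>2) * (cmod (weight \<phi> u))\<^sup>2 \<le> D"
      using weight_bound[OF assms(1)] by blast
    have "(cmod (weight \<phi> u))\<^sup>2 \<le> D" for u
      using mult_right_mono[of 1 "1 + u\<^sup>2" "(cmod (weight \<phi> u))\<^sup>2"] D(2)[of u] by simp
    then have "cmod (weight \<phi> u) \<le> sqrt D" for u
      by (rule real_le_rsqrt)
    then show ?thesis
      by (intro cauchy.integrable_const_bound[of _ "sqrt D"]) auto
  qed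
  show ?thesis using int
  proof eventually_elim
    case (elim w)
    have "filt \<phi> w t = (LINT u|cauchy_measure. incr \<phi> t w u + complex_of_real (X w t) * weight \<phi> u)"
      unfolding filt_def incr_def by (simp add: algebra_simps)
    also have "\<dots> = (LINT u|cauchy_measure. incr \<phi> t w u)"
      using elim wint by (simp add: w0)
    finally show ?case .
  qed
qed

section \<open>Shift invariance of the modulus correlation\<close>

definition corr :: "(real \<Rightarrow> complex) \<Rightarrow> (real \<Rightarrow> complex) \<Rightarrow> real \<Rightarrow> real \<Rightarrow> real" where
  "corr \<phi>1 \<phi>2 s s' = (LINT w|M. cmod (filt \<phi>1 w s) * cmod (filt \<phi>2 w s'))"

definition empirical :: "(real \<Rightarrow> complex) \<Rightarrow> real \<Rightarrow> (nat \<Rightarrow> real) \<Rightarrow> nat \<Rightarrow> 'w \<Rightarrow> complex" where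
  "empirical \<phi> t u n w = (1 / real n) *\<^sub>R (\<Sum>i<n. incr \<phi> t w (u i))"

lemma empirical_measurable [measurable]: "empirical \<phi> t u n \<in> borel_measurable M"
  unfolding empirical_def[abs_def] incr_def by measurable

text \<open>Empirical averages read only finitely many increments, so the stationarity of
  finite-dimensional laws applies to them directly.\<close>

lemma empirical_modulus_shift:
  "(LINT w|M. cmod (empirical \<phi>1 (t + h) u n w) * cmod (empirical \<phi>2 (t' + h) u n w))
    = (LINT w|M. cmod (empirical \<phi>1 t u n w) * cmod (empirical \<phi>2 t' u n w))"
proof -
  define I where "I = {t, t'} \<union> (\<lambda>i. t - u i) ` {..<n} \<union> (\<lambda>i. t' - u i) ` {..<n}"
  \<comment> \<open>\<open>L\<close> takes differences of its argument, so the common reference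
    value \<open>X w h\<close> cancels and the shifted increments yield the average at time
    \<open>s + h\<close>.\<close>
  define L where "L \<phi> s x = (1 / real n) *\<^sub>R (\<Sum>i<n. complex_of_real (x (s - u i) - x s) * weight \<phi> (u i))"
    for \<phi> s and x :: "real \<Rightarrow> real"
  have fin: "finite I" by (simp add: I_def)
  have L [measurable]: "L \<phi> s \<in> borel_measurable (PiM I (\<lambda>_. borel))"
    if "s \<in> I" "\<And>i. i < n \<Longrightarrow> s - u i \<in> I" for \<phi> s
    unfolding L_def using that by measurable
  have t: "t \<in> I" "t' \<in> I" "\<And>i. i < n \<Longrightarrow> t - u i \<in> I" "\<And>i. i < n \<Longrightarrow> t' - u i \<in> I"
    by (auto simp: I_def)
  have F: "(\<lambda>x. cmod (L \<phi>1 t x) * cmod (L \<phi>2 t' x)) \<in> borel_measurable (PiM I (\<lambda>_. borel))"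
    using L[OF t(1,3), of \<phi>1] L[OF t(2,4), of \<phi>2] by measurable
  have L_h: "L \<phi> s (\<lambda>r\<in>I. X w (r + h) - X w h) = empirical \<phi> (s + h) u n w"
    if "s \<in> I" "\<And>i. i < n \<Longrightarrow> s - u i \<in> I" for \<phi> s h w
  proof -
    have "(\<lambda>r\<in>I. X w (r + h) - X w h) (s - u i) - (\<lambda>r\<in>I. X w (r + h) - X w h) s
        = X w (s + h - u i) - X w (s + h)" if "i < n" for i
    proof -
      have eq: "s - u i + h = s + h - u i" by simp
      show ?thesis using \<open>s \<in> I\<close> \<open>\<And>i. i < n \<Longrightarrow> s - u i \<in> I\<close> that by (simp add: eq)
    qed
    then show ?thesis
      unfolding L_def empirical_def incr_def by (intro arg_cong2[where f = scaleR] refl sum.cong) simp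
  qed
  show ?thesis
    \<comment> \<open>The instances with shift 0 identify the unshifted side, where the reference
      value is \<open>X w 0\<close>.\<close>
    using integral_increments_shift[OF fin F, of h] L_h[OF t(1,3), of \<phi>1] L_h[OF t(2,4), of \<phi>2]
      L_h[OF t(1,3), of \<phi>1 _ 0] L_h[OF t(2,4), of \<phi>2 _ 0]
    by simp
qed

text \<open>One family of sample points must serve both filters at the original and at the shifted
  times, since shift invariance compares averages over the same points. The four processes are
  therefore sampled as one vector.\<close>

lemma filt_empirical_approx:
  assumes "decaying \<phi>1" "decaying \<phi>2"
    and "(LINT u|lborel. \<phi>1 u) = 0" "(LINT u|lborel. \<phi>2 u) = 0"
  shows "\<exists>C\<ge>0. \<forall>n>0. \<exists>u. \<forall>(\<phi>, s) \<in> {(\<phi>1, t), (\<phi>2, t'), (\<phi>1, t + h), (\<phi>2, t' + h)}.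
    (\<integral>\<^sup>+ w. ennreal ((cmod (empirical \<phi> s u n w - filt \<phi> w s))\<^sup>2) \<partial>M) \<le> ennreal (C / real n)"
proof -
  have [measurable]: "\<phi>1 \<in> borel_measurable borel" "\<phi>2 \<in> borel_measurable borel"
    using assms by (auto intro: decaying_measurable)
  note incr_meas [measurable] = incr_measurable[OF assms(1)] incr_measurable[OF assms(2)]
  obtain C1 where C1: "0 \<le> C1" "\<And>t u. (\<integral>\<^sup>+ w. ennreal ((cmod (incr \<phi>1 t w u))\<^sup>2) \<partial>M) \<le> ennreal C1"
    using incr_second_moment[OF assms(1)] by blast
  obtain C2 where C2: "0 \<le> C2" "\<And>t u. (\<integral>\<^sup>+ w. ennreal ((cmod (incr \<phi>2 t w u))\<^sup>2) \<partial>M) \<le> ennreal C2"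
    using incr_second_moment[OF assms(2)] by blast
  define C where "C = (C1 + C2) + (C1 + C2)"
  have C: "0 \<le> C" using C1(1) C2(1) by (simp add: C_def)
  define Y where "Y w u = ((incr \<phi>1 t w u, incr \<phi>2 t' w u), (incr \<phi>1 (t + h) w u, incr \<phi>2 (t' + h) w u))" for w u
  have Y [measurable]: "case_prod Y \<in> borel_measurable (M \<Otimes>\<^sub>M cauchy_measure)"
    unfolding Y_def case_prod_beta' borel_prod[symmetric] by measurable
  have Y_le: "(\<integral>\<^sup>+ w. ennreal ((norm (Y w u))\<^sup>2) \<partial>M) \<le> ennreal C" for u
  proof -
    have m: "(\<lambda>w. incr \<phi> s w u) \<in> borel_measurable M" for \<phi> s
      unfolding incr_def by measurable
    have "(\<integral>\<^sup>+ w. ennreal ((norm (Y w u))\<^sup>2) \<partial>M)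
        = (\<integral>\<^sup>+ w. (ennreal ((cmod (incr \<phi>1 t w u))\<^sup>2) + ennreal ((cmod (incr \<phi>2 t' w u))\<^sup>2))
          + (ennreal ((cmod (incr \<phi>1 (t + h) w u))\<^sup>2) + ennreal ((cmod (incr \<phi>2 (t' + h) w u))\<^sup>2)) \<partial>M)"
      by (intro nn_integral_cong) (simp add: Y_def norm_Pair ennreal_plus[symmetric] del: ennreal_plus)
    also have "\<dots> = ((\<integral>\<^sup>+ w. ennreal ((cmod (incr \<phi>1 t w u))\<^sup>2) \<partial>M) + (\<integral>\<^sup>+ w. ennreal ((cmod (incr \<phi>2 t' w u))\<^sup>2) \<partial>M))
        + ((\<integral>\<^sup>+ w. ennreal ((cmod (incr \<phi>1 (t + h) w u))\<^sup>2) \<partial>M) + (\<integral>\<^sup>+ w. ennreal ((cmod (incr \<phi>2 (t' + h) w u))\<^sup>2) \<partial>M))"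
      using m by (simp add: nn_integral_add)
    also have "\<dots> \<le> (ennreal C1 + ennreal C2) + (ennreal C1 + ennreal C2)"
      by (intro add_mono C1 C2)
    also have "\<dots> = ennreal C"
      using C1(1) C2(1) by (simp add: C_def ennreal_plus[symmetric] del: ennreal_plus)
    finally show ?thesis .
  qed
  have Yint: "AE w in M. integrable cauchy_measure (Y w)"
    by (rule second_moment_integral_le(3)[OF prob_space_cauchy_measure prob_space_axioms Y Y_le])
  have "\<exists>u. \<forall>(\<phi>, s) \<in> {(\<phi>1, t), (\<phi>2, t'), (\<phi>1, t + h), (\<phi>2, t' + h)}.
    (\<integral>\<^sup>+ w. ennreal ((cmod (empirical \<phi> s u n w - filt \<phi> w s))\<^sup>2) \<partial>M) \<le> ennreal ((C + 1) / real n)"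
    if n: "0 < n" for n
  proof -
    define R where "R u w = (\<Sum>i<n. Y w (u i)) - real n *\<^sub>R integral\<^sup>L cauchy_measure (Y w)" for u w
    obtain u where u: "(\<integral>\<^sup>+ w. ennreal ((norm (R u w))\<^sup>2) \<partial>M) \<le> ennreal (real n * (C + 1))"
      using empirical_approximation[OF prob_space_cauchy_measure sigma_finite_measure_axioms Y
          second_moment_integral_le(1)[OF prob_space_cauchy_measure prob_space_axioms Y Y_le] C, of n]
      unfolding R_def by blast
    have Yw [measurable]: "(\<lambda>w. Y w v) \<in> borel_measurable M" for v
      using measurable_compose[OF measurable_Pair2'[of v cauchy_measure M] Y] by simp
    have [measurable]: "R u \<in> borel_measurable M"
      unfolding R_def by measurable
    \<comment> \<open>Here \<open>p\<close> is one of the four coordinate projections: it commutes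
      with the integral and does not increase the norm, so the error of the vector controls each
      component. Dividing the sum by \<open>n\<close> turns the bound \<open>n * (C + 1)\<close>
      into \<open>(C + 1) / n\<close>.\<close>
    have comp: "(\<integral>\<^sup>+ w. ennreal ((cmod (empirical \<phi> s u n w - filt \<phi> w s))\<^sup>2) \<partial>M) \<le> ennreal ((C + 1) / real n)"
      if p: "bounded_linear p" "\<And>y. cmod (p y) \<le> norm y" "\<And>w v. p (Y w v) = incr \<phi> s w v"
        and \<phi>: "decaying \<phi>" "(LINT u|lborel. \<phi> u) = 0" for p \<phi> s
    proof -
      interpret p: bounded_linear p by fact
      have "(\<integral>\<^sup>+ w. ennreal ((cmod (empirical \<phi> s u n w - filt \<phi> w s))\<^sup>2) \<partial>M)
          \<le> (\<integral>\<^sup>+ w. ennreal (1 / (real n)\<^sup>2) * ennreal ((norm (R u w))\<^sup>2) \<partial>M)"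
      proof (rule nn_integral_mono_AE)
        show "AE w in M. ennreal ((cmod (empirical \<phi> s u n w - filt \<phi> w s))\<^sup>2)
            \<le> ennreal (1 / (real n)\<^sup>2) * ennreal ((norm (R u w))\<^sup>2)"
          using Yint filt_eq_incr[OF \<phi>, of s]
        proof eventually_elim
          case (elim w)
          have "p (integral\<^sup>L cauchy_measure (Y w)) = filt \<phi> w s"
            using integral_bounded_linear[OF p(1) elim(1)] by (simp add: p(3) elim(2))
          then have "p (R u w) = real n *\<^sub>R (empirical \<phi> s u n w - filt \<phi> w s)"
            using n by (simp add: R_def p.diff p.sum p.scaleR p(3) empirical_def scaleR_diff_right)
          then have "real n * cmod (empirical \<phi> s u n w - filt \<phi> w s) \<le> norm (R u w)"
            using p(2)[of "R u w"] by simp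
          then have "(real n * cmod (empirical \<phi> s u n w - filt \<phi> w s))\<^sup>2 \<le> (norm (R u w))\<^sup>2"
            by (intro power_mono) auto
          then have "(cmod (empirical \<phi> s u n w - filt \<phi> w s))\<^sup>2 \<le> 1 / (real n)\<^sup>2 * (norm (R u w))\<^sup>2"
            using n by (simp add: power_mult_distrib field_simps)
          then show ?case
            by (subst ennreal_mult[symmetric]) (auto intro: ennreal_leI)
        qed
      qed
      also have "\<dots> = ennreal (1 / (real n)\<^sup>2) * (\<integral>\<^sup>+ w. ennreal ((norm (R u w))\<^sup>2) \<partial>M)"
        by (rule nn_integral_cmult) measurable
      also have "\<dots> \<le> ennreal (1 / (real n)\<^sup>2) * ennreal (real n * (C + 1))"
        using u by (intro mult_left_mono) auto
      also have "\<dots> = ennreal ((C + 1) / real n)"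
        using n C by (subst ennreal_mult[symmetric]) (auto simp: power2_eq_square)
      finally show ?thesis .
    qed
    have lin: "bounded_linear (\<lambda>y. fst (fst y))" "bounded_linear (\<lambda>y. snd (fst y))"
        "bounded_linear (\<lambda>y. fst (snd y))" "bounded_linear (\<lambda>y. snd (snd y))"
      by (intro bounded_linear_fst_comp bounded_linear_snd_comp bounded_linear_fst bounded_linear_snd)+
    have nrm: "cmod (fst (fst y)) \<le> norm y" "cmod (snd (fst y)) \<le> norm y"
        "cmod (fst (snd y)) \<le> norm y" "cmod (snd (snd y)) \<le> norm y"
      for y :: "(complex \<times> complex) \<times> (complex \<times> complex)"
      using norm_fst_le[of "fst y" "snd y"] norm_snd_le[of "snd y" "fst y"]
        norm_fst_le[of "fst (fst y)" "snd (fst y)"] norm_snd_le[of "snd (fst y)" "fst (fst y)"]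
        norm_fst_le[of "fst (snd y)" "snd (snd y)"] norm_snd_le[of "snd (snd y)" "fst (snd y)"]
      unfolding prod.collapse by linarith+
    show ?thesis
      using comp[OF lin(1) nrm(1), of \<phi>1 t] comp[OF lin(2) nrm(2), of \<phi>2 t']
        comp[OF lin(3) nrm(3), of \<phi>1 "t + h"] comp[OF lin(4) nrm(4), of \<phi>2 "t' + h"] assms
      by (intro exI[of _ u]) (simp add: Y_def)
  qed
  then show ?thesis using C by (intro exI[of _ "C + 1"]) auto
qed

text \<open>Both correlations are close to expectations of empirical averages, and those two
  expectations coincide. Letting the approximation error tend to 0 gives equality.\<close>

lemma corr_shift:
  assumes "decaying \<phi>1" "decaying \<phi>2"
    and "(LINT u|lborel. \<phi>1 u) = 0" "(LINT u|lborel. \<phi>2 u) = 0"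
  shows "corr \<phi>1 \<phi>2 (t + h) (t' + h) = corr \<phi>1 \<phi>2 t t'"
proof -
  have filt_meas: "(\<lambda>w. filt \<phi> w s) \<in> borel_measurable M" if "decaying \<phi>" for \<phi> s
    using measurable_compose[OF measurable_Pair2'[of s borel M] filt_measurable[OF that]] by simp
  note [measurable] = filt_meas[OF assms(1)] filt_meas[OF assms(2)]
  obtain C where C: "0 \<le> C" "\<And>n. 0 < n \<Longrightarrow> \<exists>u. \<forall>(\<phi>, s) \<in> {(\<phi>1, t), (\<phi>2, t'), (\<phi>1, t + h), (\<phi>2, t' + h)}.
    (\<integral>\<^sup>+ w. ennreal ((cmod (empirical \<phi> s u n w - filt \<phi> w s))\<^sup>2) \<partial>M) \<le> ennreal (C / real n)"
    using filt_empirical_approx[OF assms] by blast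
  have sq: "integrable M (\<lambda>w. (cmod (filt \<phi> w s))\<^sup>2)" if "decaying \<phi>" for \<phi> s
  proof -
    obtain K where K: "0 \<le> K" "\<And>t. (\<integral>\<^sup>+ w. ennreal ((cmod (filt \<phi> w t))\<^sup>2) \<partial>M) \<le> ennreal (K * (1 + t\<^sup>2))"
      using filt_second_moment[OF \<open>decaying \<phi>\<close>] by blast
    show ?thesis
      using K square_integrable_iff_nn[OF filt_meas[OF \<open>decaying \<phi>\<close>, of s], where C = "K * (1 + s\<^sup>2)"] by simp
  qed
  define K where "K s s' = (LINT w|M. (cmod (filt \<phi>1 w s))\<^sup>2) + (LINT w|M. (cmod (filt \<phi>2 w s'))\<^sup>2)" for s s'
  define B where "B = (K t t' + 2 * C) + (K (t + h) (t' + h) + 2 * C)"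
  have "\<bar>corr \<phi>1 \<phi>2 (t + h) (t' + h) - corr \<phi>1 \<phi>2 t t'\<bar> = 0"
  proof (rule real_archimedian_rdiv_eq_0)
    fix m :: nat assume m: "0 < m"
    \<comment> \<open>Taking \<open>m^2\<close> samples makes the mean-square errors of order
      \<open>1 / m^2\<close>, which offsets the factor \<open>m\<close> in the product
      estimate.\<close>
    obtain u where u: "\<And>\<phi> s. (\<phi>, s) \<in> {(\<phi>1, t), (\<phi>2, t'), (\<phi>1, t + h), (\<phi>2, t' + h)} \<Longrightarrow>
      (\<integral>\<^sup>+ w. ennreal ((cmod (empirical \<phi> s u (m\<^sup>2) w - filt \<phi> w s))\<^sup>2) \<partial>M) \<le> ennreal (C / real (m\<^sup>2))"
      using C(2)[of "m\<^sup>2"] m by fastforce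
    define S where "S \<phi> s = empirical \<phi> s u (m\<^sup>2)" for \<phi> s
    have S [measurable]: "S \<phi> s \<in> borel_measurable M" for \<phi> s
      unfolding S_def by measurable
    have approx: "\<bar>corr \<phi>1 \<phi>2 s s' - (LINT w|M. cmod (S \<phi>1 s w) * cmod (S \<phi>2 s' w))\<bar> \<le> (K s s' + 2 * C) / m"
      if "(s, s') \<in> {(t, t'), (t + h, t' + h)}" for s s'
    proof -
      have 1: "integrable M (\<lambda>w. (cmod (S \<phi>1 s w - filt \<phi>1 w s))\<^sup>2) \<and>
          (LINT w|M. (cmod (S \<phi>1 s w - filt \<phi>1 w s))\<^sup>2) \<le> C / real (m\<^sup>2)"
        by (subst square_integrable_iff_nn[symmetric]) (use that u[of \<phi>1 s] C(1) in \<open>auto simp: S_def\<close>)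
      have 2: "integrable M (\<lambda>w. (cmod (S \<phi>2 s' w - filt \<phi>2 w s'))\<^sup>2) \<and>
          (LINT w|M. (cmod (S \<phi>2 s' w - filt \<phi>2 w s'))\<^sup>2) \<le> C / real (m\<^sup>2)"
        by (subst square_integrable_iff_nn[symmetric]) (use that u[of \<phi>2 s'] C(1) in \<open>auto simp: S_def\<close>)
      have "\<bar>corr \<phi>1 \<phi>2 s s' - (LINT w|M. cmod (S \<phi>1 s w) * cmod (S \<phi>2 s' w))\<bar>
          \<le> K s s' / m + m * ((LINT w|M. (cmod (S \<phi>1 s w - filt \<phi>1 w s))\<^sup>2)
              + (LINT w|M. (cmod (S \<phi>2 s' w - filt \<phi>2 w s'))\<^sup>2))"
        unfolding corr_def K_def
        by (rule product_expectation_approx) (use 1 2 sq assms m in auto)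
      also have "\<dots> \<le> K s s' / m + m * (C / real (m\<^sup>2) + C / real (m\<^sup>2))"
        using 1 2 by (intro add_left_mono mult_left_mono add_mono) auto
      also have "\<dots> = (K s s' + 2 * C) / m"
        using m by (simp add: power2_eq_square field_simps)
      finally show ?thesis .
    qed
    have "\<bar>corr \<phi>1 \<phi>2 (t + h) (t' + h) - corr \<phi>1 \<phi>2 t t'\<bar> \<le> B / m"
      using approx[of t t'] approx[of "t + h" "t' + h"]
      unfolding S_def empirical_modulus_shift B_def add_divide_distrib by fastforce
    then show "real m * \<bar>corr \<phi>1 \<phi>2 (t + h) (t' + h) - corr \<phi>1 \<phi>2 t t'\<bar> \<le> B"
      using m by (simp add: field_simps)
  qed simp
  then show ?thesis by simp
qed

section \<open>Scattering cross-spectrum\<close>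

lemma filt_slice_measurable:
  assumes "decaying \<phi>"
  shows "(\<lambda>w. filt \<phi> w t) \<in> borel_measurable M"
    and "w \<in> space M \<Longrightarrow> filt \<phi> w \<in> borel_measurable borel"
  using measurable_compose[OF measurable_Pair2'[of t borel M] filt_measurable[OF assms]]
    measurable_compose[OF measurable_Pair1'[of w M borel] filt_measurable[OF assms]] by simp_all

lemma WX_eq_filt:
  assumes "is_wavelet psi" "w \<in> space M"
  shows "WX X psi w t j = filt (psi_dil psi j) w t"
proof -
  have [measurable]: "psi_dil psi j \<in> borel_measurable borel"
    using psi_dil_decaying[OF assms(1)] by (rule decaying_measurable)
  have [measurable]: "(\<lambda>u. X w (t - u)) \<in> borel_measurable borel"
    using assms(2) by measurable
  show ?thesis
    unfolding WX_def conv_psi_dil_0 filt_def by (rule integral_weight[symmetric]) measurable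
qed

text \<open>The second filter is handled like the first: the modulus has quadratically growing
  second moment, and the weight of the second filter absorbs the growth in
  \<open>c * u\<close>.\<close>

lemma modulus_second_moment:
  assumes "decaying \<phi>" "decaying \<theta>"
  shows "\<exists>C. \<forall>u. (\<integral>\<^sup>+ w. ennreal ((cmod (complex_of_real (cmod (filt \<phi> w (t - c * u))) * weight \<theta> u))\<^sup>2) \<partial>M)
    \<le> ennreal C"
proof -
  obtain A where A: "0 \<le> A" "\<And>t. (\<integral>\<^sup>+ w. ennreal ((cmod (filt \<phi> w t))\<^sup>2) \<partial>M) \<le> ennreal (A * (1 + t\<^sup>2))"
    using filt_second_moment[OF assms(1)] by blast
  obtain B where B: "0 \<le> B" "\<And>u. (1 + u\<^sup>2) * (cmod (weight \<theta> u))\<^sup>2 \<le> B"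
    using weight_bound[OF assms(2)] by blast
  define D where "D = A * (2 * (1 + t\<^sup>2) * (1 + c\<^sup>2))"
  have D: "0 \<le> D" using A(1) by (simp add: D_def)
  have "(\<integral>\<^sup>+ w. ennreal ((cmod (complex_of_real (cmod (filt \<phi> w (t - c * u))) * weight \<theta> u))\<^sup>2) \<partial>M)
      \<le> ennreal (D * B)" for u
  proof -
    have "1 + (c * u)\<^sup>2 \<le> (1 + c\<^sup>2) * (1 + u\<^sup>2)"
      by (simp add: power_mult_distrib algebra_simps)
    then have "2 * (1 + t\<^sup>2) * (1 + (c * u)\<^sup>2) \<le> 2 * (1 + t\<^sup>2) * ((1 + c\<^sup>2) * (1 + u\<^sup>2))"
      by (rule mult_left_mono) simp
    then have "1 + (t - c * u)\<^sup>2 \<le> 2 * (1 + t\<^sup>2) * (1 + c\<^sup>2) * (1 + u\<^sup>2)"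
      using one_plus_square_diff_le[of t "c * u"] by (simp only: mult.assoc)
    then have "A * (1 + (t - c * u)\<^sup>2) \<le> D * (1 + u\<^sup>2)"
      unfolding D_def mult.assoc by (rule mult_left_mono[OF _ A(1)])
    then have "A * (1 + (t - c * u)\<^sup>2) * (cmod (weight \<theta> u))\<^sup>2 \<le> D * (1 + u\<^sup>2) * (cmod (weight \<theta> u))\<^sup>2"
      by (rule mult_right_mono) simp
    also have "\<dots> \<le> D * B"
      unfolding mult.assoc by (intro mult_left_mono B D)
    finally have le: "A * (1 + (t - c * u)\<^sup>2) * (cmod (weight \<theta> u))\<^sup>2 \<le> D * B" .
    have "(\<integral>\<^sup>+ w. ennreal ((cmod (complex_of_real (cmod (filt \<phi> w (t - c * u))) * weight \<theta> u))\<^sup>2) \<partial>M)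
        = (\<integral>\<^sup>+ w. ennreal ((cmod (filt \<phi> w (t - c * u)))\<^sup>2) * ennreal ((cmod (weight \<theta> u))\<^sup>2) \<partial>M)"
      by (simp add: norm_mult power_mult_distrib ennreal_mult)
    also have "\<dots> = (\<integral>\<^sup>+ w. ennreal ((cmod (filt \<phi> w (t - c * u)))\<^sup>2) \<partial>M) * ennreal ((cmod (weight \<theta> u))\<^sup>2)"
      using filt_slice_measurable(1)[OF assms(1)] by (intro nn_integral_multc) measurable
    also have "\<dots> \<le> ennreal (A * (1 + (t - c * u)\<^sup>2)) * ennreal ((cmod (weight \<theta> u))\<^sup>2)"
      by (intro mult_right_mono A) simp
    also have "\<dots> = ennreal (A * (1 + (t - c * u)\<^sup>2) * (cmod (weight \<theta> u))\<^sup>2)"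
      using A(1) by (simp add: ennreal_mult)
    also have "\<dots> \<le> ennreal (D * B)"
      using le by (rule ennreal_leI)
    finally show ?thesis .
  qed
  then show ?thesis by blast
qed

text \<open>Rescaling time by \<open>2 powr j\<close> leaves both outer filters at scale
  \<open>-b\<close>, so \<open>j\<close> survives only in the normalized correlation and its times.
  That is the quantity which the hypothesis of the theorem controls.\<close>

lemma scattering_eq_corr:
  assumes psi: "is_wavelet psi"
  shows "C_S M X psi t j a b = (LINT u|cauchy_measure. LINT v|cauchy_measure.
    complex_of_real (corr (psi_dil psi j) (psi_dil psi (j - a)) (t - 2 powr j * u) (t - 2 powr j * v)
        / (sigmaW M X psi j * sigmaW M X psi (j - a)))
      * (weight (psi_dil psi (- b)) u * cnj (weight (psi_dil psi (- b)) v)))"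
proof -
  define c where "c = 2 powr real_of_int j"
  define g where "g = weight (psi_dil psi (- b))"
  define s where "s = sigmaW M X psi j * sigmaW M X psi (j - a)"
  define G where "G k w u = complex_of_real (cmod (filt (psi_dil psi k) w (t - c * u))) * g u" for k w u
  note dec = psi_dil_decaying[OF psi]
  have [measurable]: "psi_dil psi k \<in> borel_measurable borel" for k
    by (rule decaying_measurable[OF dec])
  have [measurable]: "g \<in> borel_measurable borel"
    unfolding g_def by measurable
  have conv_eq: "conv (\<lambda>r. complex_of_real (cmod (WX X psi w r k))) (psi_dil psi (j - b)) t
      = (LINT u|cauchy_measure. G k w u)" if w: "w \<in> space M" for k w
  proof -
    have [measurable]: "filt (psi_dil psi k) w \<in> borel_measurable borel"
      by (rule filt_slice_measurable(2)[OF dec w])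
    show ?thesis
      using conv_psi_dil[of "\<lambda>r. complex_of_real (cmod (WX X psi w r k))" psi j "- b" t]
      unfolding WX_eq_filt[OF psi w] G_def g_def c_def
      by (subst integral_weight) simp_all
  qed
  have G_meas: "case_prod (G k) \<in> borel_measurable (M \<Otimes>\<^sub>M cauchy_measure)" for k
  proof -
    have [measurable]: "case_prod (filt (psi_dil psi k)) \<in> borel_measurable (M \<Otimes>\<^sub>M borel)"
      by (rule filt_measurable[OF dec])
    show ?thesis unfolding G_def case_prod_beta' by measurable
  qed
  obtain C1 where C1: "\<And>u. (\<integral>\<^sup>+ w. ennreal ((cmod (G j w u))\<^sup>2) \<partial>M) \<le> ennreal C1"
    using modulus_second_moment[OF dec[of j] dec[of "- b"], of t c] unfolding G_def g_def by blast
  obtain C2 where C2: "\<And>u. (\<integral>\<^sup>+ w. ennreal ((cmod (G (j - a) w u))\<^sup>2) \<partial>M) \<le> ennreal C2"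
    using modulus_second_moment[OF dec[of "j - a"] dec[of "- b"], of t c] unfolding G_def g_def by blast
  have "(LINT w|M. conv (\<lambda>r. complex_of_real (cmod (WX X psi w r j))) (psi_dil psi (j - b)) t
        * cnj (conv (\<lambda>r. complex_of_real (cmod (WX X psi w r (j - a)))) (psi_dil psi (j - b)) t))
      = (LINT w|M. (LINT u|cauchy_measure. G j w u) * cnj (LINT v|cauchy_measure. G (j - a) w v))"
    by (intro Bochner_Integration.integral_cong refl) (simp add: conv_eq)
  also have "\<dots> = (LINT u|cauchy_measure. LINT v|cauchy_measure. LINT w|M. G j w u * cnj (G (j - a) w v))"
  proof (rule cross_moment_integral[OF prob_space_cauchy_measure prob_space_axioms G_meas G_meas])
    show "(\<integral>\<^sup>+ w. ennreal ((cmod (G j w u))\<^sup>2) \<partial>M) \<le> ennreal (max C1 C2)" for u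
      using C1[of u] by (rule order_trans) (simp add: ennreal_leI)
    show "(\<integral>\<^sup>+ w. ennreal ((cmod (G (j - a) w u))\<^sup>2) \<partial>M) \<le> ennreal (max C1 C2)" for u
      using C2[of u] by (rule order_trans) (simp add: ennreal_leI)
  qed
  also have "\<dots> = (LINT u|cauchy_measure. LINT v|cauchy_measure.
      complex_of_real (corr (psi_dil psi j) (psi_dil psi (j - a)) (t - c * u) (t - c * v)) * (g u * cnj (g v)))"
  proof (intro Bochner_Integration.integral_cong refl)
    fix u v
    have "(LINT w|M. G j w u * cnj (G (j - a) w v))
        = (LINT w|M. complex_of_real (cmod (filt (psi_dil psi j) w (t - c * u))
              * cmod (filt (psi_dil psi (j - a)) w (t - c * v))) * (g u * cnj (g v)))"
      by (intro Bochner_Integration.integral_cong refl) (simp add: G_def mult_ac)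
    also have "\<dots> = complex_of_real (corr (psi_dil psi j) (psi_dil psi (j - a)) (t - c * u) (t - c * v)) * (g u * cnj (g v))"
      by (simp only: integral_mult_left_zero integral_complex_of_real corr_def)
    finally show "(LINT w|M. G j w u * cnj (G (j - a) w v)) = \<dots>" .
  qed
  finally have "C_S M X psi t j a b = (LINT u|cauchy_measure. LINT v|cauchy_measure.
      complex_of_real (corr (psi_dil psi j) (psi_dil psi (j - a)) (t - c * u) (t - c * v)) * (g u * cnj (g v)))
        / complex_of_real s"
    unfolding C_S_def s_def by (simp only:)
  \<comment> \<open>The normalization moves inside the integrals because the hypothesis compares
    normalized correlations only. If it vanishes, both sides are 0.\<close>
  also have "\<dots> = (LINT u|cauchy_measure. LINT v|cauchy_measure.
      complex_of_real (corr (psi_dil psi j) (psi_dil psi (j - a)) (t - c * u) (t - c * v) / s) * (g u * cnj (g v)))"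
    by (simp only: of_real_divide times_divide_eq_left integral_divide_zero)
  finally show ?thesis by (simp add: c_def g_def s_def)
qed

lemma modulus_correlation_eq_corr:
  assumes "is_wavelet psi"
  shows "C_rhoW M X psi t \<tau> j a $ 2 $ 2 = complex_of_real
    (corr (psi_dil psi j) (psi_dil psi (j - a)) t (t - 2 powr j * \<tau>)
      / (sigmaW M X psi j * sigmaW M X psi (j - a)))"
proof -
  have "(LINT w|M. outer (rho (WX X psi w t j)) (rho (WX X psi w (t - 2 powr j * \<tau>) (j - a))) $ 2 $ 2)
      = (LINT w|M. complex_of_real (cmod (filt (psi_dil psi j) w t)
          * cmod (filt (psi_dil psi (j - a)) w (t - 2 powr j * \<tau>))))"
    by (intro Bochner_Integration.integral_cong refl)
       (simp add: outer_def rho_def WX_eq_filt[OF assms])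
  also have "\<dots> = complex_of_real (corr (psi_dil psi j) (psi_dil psi (j - a)) t (t - 2 powr j * \<tau>))"
    unfolding corr_def by (rule integral_complex_of_real)
  finally show ?thesis
    by (simp add: C_rhoW_def)
qed

end

section \<open>Invariance of the scattering cross-spectrum across scales\<close>

theorem theorem2:
  fixes M :: "'w measure" and X :: "'w \<Rightarrow> real \<Rightarrow> real"
    and psi :: "real \<Rightarrow> complex" and J :: int
  assumes "prob_space M"
    and "(\<lambda>(w, t). X w t) \<in> borel_measurable (M \<Otimes>\<^sub>M lborel)"
    and "stationary_increments M X"
    and "\<And>t. integrable M (\<lambda>w. (X w t)\<^sup>2)"
    and "is_wavelet psi"
    and "\<And>t \<tau> j a. j \<le> J \<Longrightarrow> C_rhoW M X psi t \<tau> j a = C_rhoW M X psi t \<tau> 0 a"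
  shows "\<And>t j a b. j \<le> J \<Longrightarrow> C_S M X psi t j a b = C_S M X psi t 0 a b"
proof -
  fix t :: real and j a b :: int
  assume j: "j \<le> J"
  interpret prob_space M by fact
  interpret increment_process M X
  proof
    have "sets (M \<Otimes>\<^sub>M lborel) = sets (M \<Otimes>\<^sub>M (borel :: real measure))"
      by (intro sets_pair_measure_cong) simp_all
    then show "case_prod X \<in> borel_measurable (M \<Otimes>\<^sub>M borel)"
      using assms(2) by (simp cong: measurable_cong_sets)
  qed (use assms in auto)
  note psi = \<open>is_wavelet psi\<close>
  define \<kappa> where "\<kappa> i s r = corr (psi_dil psi i) (psi_dil psi (i - a)) s r
    / (sigmaW M X psi i * sigmaW M X psi (i - a))" for i s r
  have scale: "\<kappa> j s (s - 2 powr j * \<tau>) = \<kappa> 0 s (s - \<tau>)" for s \<tau>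
    using assms(6)[OF j, of s \<tau> a] modulus_correlation_eq_corr[OF psi, of s \<tau> j a]
      modulus_correlation_eq_corr[OF psi, of s \<tau> 0 a]
    by (simp add: \<kappa>_def del: of_real_mult of_real_divide)
  have shift: "\<kappa> 0 (s + h) (r + h) = \<kappa> 0 s r" for s r h
    unfolding \<kappa>_def
    by (simp add: corr_shift psi_dil_decaying integral_psi_dil psi)
  \<comment> \<open>The two times differ by \<open>2 powr j * (v - u)\<close>. The hypothesis with
    lag \<open>v - u\<close> brings the scale to 0 but keeps the first time; a shift by
    \<open>2 powr j * u - u\<close> then moves it to \<open>t - u\<close>.\<close>
  have "\<kappa> j (t - 2 powr j * u) (t - 2 powr j * v) = \<kappa> 0 (t - u) (t - v)" for u v
  proof -
    have "\<kappa> j (t - 2 powr j * u) (t - 2 powr j * v) = \<kappa> 0 (t - 2 powr j * u) (t - 2 powr j * u - (v - u))"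
      using scale[of "t - 2 powr j * u" "v - u"] by (simp add: algebra_simps)
    also have "\<dots> = \<kappa> 0 (t - u) (t - v)"
      using shift[of "t - 2 powr j * u" "2 powr j * u - u" "t - 2 powr j * u - (v - u)"]
      by (simp add: algebra_simps)
    finally show ?thesis .
  qed
  then show "C_S M X psi t j a b = C_S M X psi t 0 a b"
    unfolding scattering_eq_corr[OF psi] \<kappa>_def by simp
qed

end
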